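(* For $k\ge1$ let $$C_{2k-1}=\Big\{\big(\cot\tfrac{\theta}{2}\cot(k\theta),\ \cot(k\theta)\cot((k-\tfrac12)\theta)\big):\ \tfrac{(2k-2)\pi}{2k-1}<\theta<\tfrac{(2k-1)\pi}{2k}\Big\},$$ $$C_{2k}=\Big\{\big(-\cot\tfrac{\theta}{2}\cot(k\theta),\ \cot(k\theta)\cot((k+\tfrac12)\theta)\big):\ \tfrac{(2k-1)\pi}{2k}<\theta<\tfrac{2k\pi}{2k+1}\Big\}.$$ The allowed regions of the capture processes $(32)^n$ and $(2)(32)^n$, $n\ge1$, cover the whole region $\{(a,b): b\ge a>0\}$, and those of $(21)^n$ and $(21)^n(2)$, $n\ge 1$, cover the whole region $\{(a,b): a\ge b>0\}$. Moreover these regions are non-overlapping: for every $(a,b)$ with $a,b>0$ such that neither $(a,b)$ nor $(b,a)$ lies on any of the curves $C_m$, $m\ge1$, exactly one of the collision sequences $(32)^n$, $(2)(32)^n$, $(21)^n$, $(21)^n(2)$ $(n=1,2,3,\dots)$ is allowed as a capture process for mass ratios $(a,b)$.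
   Context: Setting: three point particles 1, 2, 3 move in the plane, identified with $\mathbb{C}$, with masses $m_1,m_2,m_3>0$; put $a=m_1/m_2$, $b=m_3/m_2$. Between collisions particles move freely with constant velocity. A collision "$(i)$", $i\in\{1,2,3\}$, is a collision between the two particles other than $i$ (the spectator): the two particles are at the same position with nonzero relative velocity, and instantaneously their velocities change so that their total momentum is conserved and their relative velocity is multiplied by a complex number $x=e^{i\alpha}$, $|x|=1$ (so kinetic energy is conserved); the spectator's velocity is unchanged. The number $x$ (the scattering angle $\alpha$) may be any unit complex number and may be chosen independently at each collision. A collision sequence is written as a string in order of occurrence from left to right; e.g. $(32)^n$ is $(3)(2)\cdots(3)(2)$ with $2n$ collisions, and $(2)(32)^n$ is (2) followed by $(32)^n$. The times between successive collisions are required to be strictly positive, and no other interactions occur. Capture process: initially particles 2 and 3 are at rest at distinct points, and particle 1 has a nonzero velocity. A collision sequence is allowed as a capture process for $(a,b)$ if there exist initial positions and velocity of particle 1, initial positions of 2 and 3, and scattering angles such that the collisions of the sequence occur in that order, and after the last collision particles 1 and 2 have equal velocities. The allowed region of a sequence is the set of $(a,b)$, $a,b>0$, for which it is allowed. *)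

theory Defs
  imports "HOL-Analysis.Analysis"
begin

datatype particle = P1 | P2 | P3

text \<open>
  A collision is labelled by its spectator: collision \<open>i\<close> takes place between the two particles
  other than \<open>i\<close>. The factor \<open>x\<close> may be any unit complex number, including \<open>1\<close>.
\<close>

definition meet_at :: "particle \<Rightarrow> (particle \<Rightarrow> complex) \<Rightarrow> bool" where
  "meet_at i r \<longleftrightarrow> (\<forall>j k. distinct [i, j, k] \<longrightarrow> r j = r k)"

definition scatter ::
  "(particle \<Rightarrow> real) \<Rightarrow> particle \<Rightarrow> complex \<Rightarrow> (particle \<Rightarrow> complex) \<Rightarrow> (particle \<Rightarrow> complex) \<Rightarrow> bool" where
  "scatter m i x v v' \<longleftrightarrow>
     cmod x = 1 \<and> v' i = v i \<and>
     (\<forall>j k. distinct [i, j, k] \<longrightarrow>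
        v j \<noteq> v k \<and>
        complex_of_real (m j) * v' j + complex_of_real (m k) * v' k =
          complex_of_real (m j) * v j + complex_of_real (m k) * v k \<and>
        v' j - v' k = x * (v j - v k))"

text \<open>
  \<open>evolves m r v s r' v'\<close>: starting with positions \<open>r\<close> and velocities \<open>v\<close>, the collisions of \<open>s\<close>
  occur in the order of the list, each after a strictly positive time of free motion, and \<open>r'\<close>, \<open>v'\<close>
  are the positions and velocities immediately after the last one. Velocities change only at the
  listed collisions.
\<close>

inductive evolves ::
  "(particle \<Rightarrow> real) \<Rightarrow> (particle \<Rightarrow> complex) \<Rightarrow> (particle \<Rightarrow> complex) \<Rightarrow> particle list \<Rightarrow>
   (particle \<Rightarrow> complex) \<Rightarrow> (particle \<Rightarrow> complex) \<Rightarrow> bool"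
  for m :: "particle \<Rightarrow> real" where
  no_collision: "evolves m r v [] r v"
| collision: "\<lbrakk>t > 0; r1 = (\<lambda>p. r p + complex_of_real t * v p); meet_at i r1; scatter m i x v v1;
     evolves m r1 v1 s r2 v2\<rbrakk> \<Longrightarrow> evolves m r v (i # s) r2 v2"

definition capture_process :: "(particle \<Rightarrow> real) \<Rightarrow> particle list \<Rightarrow> bool" where
  "capture_process m s \<longleftrightarrow>
     (\<exists>r v r' v'. v P2 = 0 \<and> v P3 = 0 \<and> r P2 \<noteq> r P3 \<and> v P1 \<noteq> 0 \<and>
        evolves m r v s r' v' \<and> v' P1 = v' P2)"

definition allowed_region :: "particle list \<Rightarrow> (real \<times> real) set" where
  "allowed_region s =
     {(m P1 / m P2, m P3 / m P2) | m. (\<forall>p. m p > 0) \<and> capture_process m s}"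

definition rep :: "nat \<Rightarrow> particle list \<Rightarrow> particle list" where
  "rep n s = concat (replicate n s)"

definition odd_curve :: "nat \<Rightarrow> (real \<times> real) set" where
  "odd_curve k =
     {(cot (\<theta> / 2) * cot (real k * \<theta>), cot (real k * \<theta>) * cot ((real k - 1 / 2) * \<theta>)) | \<theta>.
        (2 * real k - 2) * pi / (2 * real k - 1) < \<theta> \<and> \<theta> < (2 * real k - 1) * pi / (2 * real k)}"

definition even_curve :: "nat \<Rightarrow> (real \<times> real) set" where
  "even_curve k =
     {(- cot (\<theta> / 2) * cot (real k * \<theta>), cot (real k * \<theta>) * cot ((real k + 1 / 2) * \<theta>)) | \<theta>.
        (2 * real k - 1) * pi / (2 * real k) < \<theta> \<and> \<theta> < 2 * real k * pi / (2 * real k + 1)}"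

definition capture_curve :: "nat \<Rightarrow> (real \<times> real) set" where
  "capture_curve m = (if odd m then odd_curve ((m + 1) div 2) else even_curve (m div 2))"

end

(*
  In mass-weighted relative coordinates the configuration space is C^2, collision i happens on a
  complex line L_i, and it preserves the component of the velocity v along L_i and the modulus of
  the orthogonal component. Since the position r lies on L_i, the Hermitian product <r, v> and |v|
  are preserved, so along the whole motion Im <r, v> is constant, Re <r, v> grows linearly in time,
  and |r|^2 |v|^2 - (Re <r, v>)^2 is a constant K > 0. Put Re <r, v> = sqrt K tan u, so that
  -pi/2 < u < pi/2. Travelling from L_i to L_j increases u by an angle d with
  kappa sin d = sin(angle between L_i and L_j), where kappa^2 = 1 - (Im <r, v>)^2 / K.
  The condition v2 = v3 at the start says that v lies on L_1, i.e. that the motion comes from L_1 at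
  u = -pi/2; likewise v1 = v2 at the end means that it tends to L_3 at u = pi/2. Hence a sequence is a
  capture process iff, for some kappa in (0, 1], the turns of the chain L_1, L_i1, ..., L_3 sum to pi.

  The lines make acute angles A (L_2, L_3), B (L_1, L_3), C (L_1, L_2) with A + B + C = pi,
  a = tan A / tan B and b = tan C / tan B. The chains of (32)^n and (2)(32)^n have k = 2n and
  k = 2n + 1 turns through A and one through B or C, and the condition becomes
  (k - 1) A <= C and pi - C <= (k + 1) A for even k, and C <= k A <= pi - C for odd k. For A <= C
  the odd multiples of A jump from below C to above pi - C hitting [C, pi - C], whose length is less
  than 2A, at most once; this singles out k, up to coincidences j A = C or (j + 1) A = pi - C, which
  are the curves C_j. The other two families are obtained by exchanging A and C.
*)

theory Submission
  imports Defs
begin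

subsection \<open>Mass-weighted geometry of the collision lines\<close>

fun third :: "particle \<Rightarrow> particle \<Rightarrow> particle" where
  "third i j = (if P1 \<notin> {i, j} then P1 else if P2 \<notin> {i, j} then P2 else P3)"

lemma distinct_third: "i \<noteq> j \<Longrightarrow> distinct [i, j, third i j]"
  by (cases i; cases j) auto

lemma ex_distinct: "\<exists>j k. distinct [i :: particle, j, k]"
  using distinct_third[of i "if i = P1 then P2 else P1"] by (cases i) auto

definition total_mass :: "(particle \<Rightarrow> real) \<Rightarrow> real" where
  "total_mass m = m P1 + m P2 + m P3"

lemma total_mass_eq: "distinct [i, j, k] \<Longrightarrow> total_mass m = m i + m j + m k"
  by (cases i; cases j; cases k) (auto simp: total_mass_def)

text \<open>
  Up to the factor \<^term>\<open>total_mass m\<close>, the mass-weighted Hermitian product of two configurations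
  taken relative to their centres of mass.
\<close>

definition rel_form ::
  "(particle \<Rightarrow> real) \<Rightarrow> (particle \<Rightarrow> complex) \<Rightarrow> (particle \<Rightarrow> complex) \<Rightarrow> complex" where
  "rel_form m u w =
     of_real (m P1 * m P2) * (u P1 - u P2) * cnj (w P1 - w P2) +
     of_real (m P2 * m P3) * (u P2 - u P3) * cnj (w P2 - w P3) +
     of_real (m P3 * m P1) * (u P3 - u P1) * cnj (w P3 - w P1)"

definition rel_norm2 :: "(particle \<Rightarrow> real) \<Rightarrow> (particle \<Rightarrow> complex) \<Rightarrow> real" where
  "rel_norm2 m u =
     m P1 * m P2 * (cmod (u P1 - u P2))\<^sup>2 +
     m P2 * m P3 * (cmod (u P2 - u P3))\<^sup>2 +
     m P3 * m P1 * (cmod (u P3 - u P1))\<^sup>2"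

lemma rel_form_perm:
  assumes "distinct [i, j, k]"
  shows "rel_form m u w =
     of_real (m i * m j) * (u i - u j) * cnj (w i - w j) +
     of_real (m j * m k) * (u j - u k) * cnj (w j - w k) +
     of_real (m k * m i) * (u k - u i) * cnj (w k - w i)"
  using assms by (cases i; cases j; cases k) (auto simp: rel_form_def algebra_simps)

lemma rel_form_self: "rel_form m u u = of_real (rel_norm2 m u)"
  unfolding rel_form_def rel_norm2_def of_real_add of_real_mult complex_norm_square
  by (simp only: mult.assoc)

lemma cnj_rel_form: "cnj (rel_form m u w) = rel_form m w u"
  by (simp add: rel_form_def algebra_simps)

lemma rel_form_add_right:
  "rel_form m u (\<lambda>p. w p + of_real t * z p) = rel_form m u w + of_real t * rel_form m u z"
  by (simp add: rel_form_def algebra_simps)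

lemma rel_form_add_left:
  "rel_form m (\<lambda>p. w p + of_real t * z p) u = rel_form m w u + of_real t * rel_form m z u"
  by (simp add: rel_form_def algebra_simps)

lemma rel_norm2_add:
  "rel_norm2 m (\<lambda>p. u p + of_real t * w p) =
     rel_norm2 m u + 2 * t * Re (rel_form m u w) + t\<^sup>2 * rel_norm2 m w"
proof -
  have "complex_of_real (rel_norm2 m (\<lambda>p. u p + of_real t * w p)) =
      of_real (rel_norm2 m u) + of_real t * (rel_form m u w + cnj (rel_form m u w)) +
      of_real (t\<^sup>2 * rel_norm2 m w)"
    unfolding rel_form_self[symmetric] rel_form_add_left rel_form_add_right cnj_rel_form
    by (simp add: algebra_simps rel_form_self power2_eq_square)
  also have "\<dots> = of_real (rel_norm2 m u + 2 * t * Re (rel_form m u w) + t\<^sup>2 * rel_norm2 m w)"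
    by (simp add: complex_add_cnj)
  finally show ?thesis
    using of_real_eq_iff by blast
qed

lemma rel_form_translate: "(\<And>p. w' p = w p + c) \<Longrightarrow> rel_form m u w' = rel_form m u w"
  by (simp add: rel_form_def)

lemma rel_norm2_translate: "(\<And>p. w' p = w p + c) \<Longrightarrow> rel_norm2 m w' = rel_norm2 m w"
  by (simp add: rel_norm2_def)

text \<open>This is \<open>m j + m k\<close> times the coordinate of \<open>i\<close> relative to
  the centre of mass of \<open>j\<close> and \<open>k\<close>. For velocities it survives a
  collision with spectator \<open>i\<close>.\<close>

definition spectator_part ::
  "(particle \<Rightarrow> real) \<Rightarrow> particle \<Rightarrow> particle \<Rightarrow> particle \<Rightarrow> (particle \<Rightarrow> complex) \<Rightarrow> complex" where
  "spectator_part m i j k u = of_real (m j) * (u i - u j) + of_real (m k) * (u i - u k)"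

text \<open>Jacobi coordinates adapted to the pair \<open>j\<close>, \<open>k\<close>.\<close>

lemma rel_form_decompose:
  assumes "distinct [i, j, k]"
  shows "of_real (m j + m k) * rel_form m u w =
    of_real (m i) * spectator_part m i j k u * cnj (spectator_part m i j k w) +
    of_real (m j * m k * total_mass m) * (u j - u k) * cnj (w j - w k)"
  unfolding rel_form_perm[OF assms(1)] spectator_part_def total_mass_eq[OF assms(1)]
  by (simp add: algebra_simps)

lemma rel_norm2_decompose:
  assumes "distinct [i, j, k]"
  shows "(m j + m k) * rel_norm2 m u =
    m i * (cmod (spectator_part m i j k u))\<^sup>2 + m j * m k * total_mass m * (cmod (u j - u k))\<^sup>2"
proof -
  have "complex_of_real ((m j + m k) * rel_norm2 m u) = of_real (m j + m k) * rel_form m u u"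
    by (simp add: rel_form_self)
  also have "\<dots> = complex_of_real
     (m i * (cmod (spectator_part m i j k u))\<^sup>2 + m j * m k * total_mass m * (cmod (u j - u k))\<^sup>2)"
    by (subst rel_form_decompose[OF assms])
      (simp only: of_real_add of_real_mult complex_norm_square mult.assoc)
  finally show ?thesis
    using of_real_eq_iff by blast
qed

lemma meet_at_iff: "distinct [i, j, k] \<Longrightarrow> meet_at i r \<longleftrightarrow> r j = r k"
  by (cases i; cases j; cases k) (auto simp: meet_at_def, (metis particle.exhaust)+)

lemma scatter_iff:
  assumes "distinct [i, j, k]"
  shows "scatter m i x v v' \<longleftrightarrow> cmod x = 1 \<and> v' i = v i \<and> v j \<noteq> v k \<and>
     of_real (m j) * v' j + of_real (m k) * v' k = of_real (m j) * v j + of_real (m k) * v k \<and>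
     v' j - v' k = x * (v j - v k)"
proof -
  have *: "distinct [i, j', k'] \<longleftrightarrow> j' = j \<and> k' = k \<or> j' = k \<and> k' = j" for j' k'
    using assms by (cases i; cases j; cases k; cases j'; cases k') auto
  show ?thesis
    unfolding scatter_def * by (auto simp: algebra_simps)
qed

lemma spectator_part_scatter:
  assumes "distinct [i, j, k]" "scatter m i x v v'"
  shows "spectator_part m i j k v' = spectator_part m i j k v"
proof -
  have "spectator_part m i j k w = of_real (m j + m k) * w i - (of_real (m j) * w j + of_real (m k) * w k)" for w
    by (simp add: spectator_part_def algebra_simps)
  then show ?thesis
    using assms by (simp add: scatter_iff)
qed

text \<open>\<open>coll_angle m k\<close> is the angle between the collision lines of the two labels other than \<open>k\<close>.\<close>

definition coll_angle :: "(particle \<Rightarrow> real) \<Rightarrow> particle \<Rightarrow> real" where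
  "coll_angle m k = arctan (m k * sqrt (total_mass m / (m P1 * m P2 * m P3)))"

lemma tan_coll_angle: "tan (coll_angle m k) = m k * sqrt (total_mass m / (m P1 * m P2 * m P3))"
  by (simp add: coll_angle_def tan_arctan)

section \<open>Invariants of a collision and angles between the collision lines\<close>

locale three_masses =
  fixes m :: "particle \<Rightarrow> real"
  assumes pos: "m p > 0"
begin

lemma rel_norm2_nonneg: "rel_norm2 m u \<ge> 0"
  unfolding rel_norm2_def by (intro add_nonneg_nonneg mult_nonneg_nonneg) (auto intro: less_imp_le pos)

text \<open>On L_i the relative coordinate of the pair vanishes, so only the spectator part of the
  velocity enters the product with \<open>r\<close>, and a collision keeps that part.\<close>

lemma rel_form_scatter:
  assumes "meet_at i r" "scatter m i x v v'"
  shows "rel_form m r v' = rel_form m r v"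
proof -
  obtain j k where d: "distinct [i, j, k]" using ex_distinct by blast
  have "of_real (m j + m k) * rel_form m r v' = of_real (m j + m k) * rel_form m r v"
    unfolding rel_form_decompose[OF d] spectator_part_scatter[OF d assms(2)]
    using assms(1) d by (simp add: meet_at_iff)
  moreover have "m j + m k \<noteq> 0" using pos[of j] pos[of k] by linarith
  ultimately show ?thesis
    by (metis mult_left_cancel of_real_eq_0_iff)
qed

lemma rel_norm2_scatter:
  assumes "scatter m i x v v'"
  shows "rel_norm2 m v' = rel_norm2 m v"
proof -
  obtain j k where d: "distinct [i, j, k]" using ex_distinct by blast
  have "cmod (v' j - v' k) = cmod (v j - v k)"
    using assms d by (simp add: scatter_iff norm_mult)
  then have "(m j + m k) * rel_norm2 m v' = (m j + m k) * rel_norm2 m v"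
    unfolding rel_norm2_decompose[OF d] spectator_part_scatter[OF d assms]
    by simp
  moreover have "m j + m k \<noteq> 0" using pos[of j] pos[of k] by linarith
  ultimately show ?thesis by simp
qed

text \<open>Completeness of the collision law, used to build motions. The product with
  \<open>r\<close> determines the spectator part of the velocity, and the norm then determines the
  modulus of the relative velocity of the pair. So \<open>w\<close> is a possible outcome up to a
  common shift, which the unchanged velocity of the spectator fixes.\<close>

lemma scatter_to:
  assumes r: "meet_at i r" "rel_norm2 m r \<noteq> 0"
    and v: "\<not> meet_at i v"
    and w: "rel_form m r w = rel_form m r v" "rel_norm2 m w = rel_norm2 m v"
  obtains x v' c where "scatter m i x v v'" "\<And>p. v' p = w p + c"
proof -
  obtain j k where d: "distinct [i, j, k]" using ex_distinct by blast
  define v' where "v' = (\<lambda>p. w p + (v i - w i))"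
  have vjk: "v j \<noteq> v k" using v d by (simp add: meet_at_iff)
  have mjk: "m j + m k \<noteq> 0" using pos[of j] pos[of k] by linarith
  have rjk: "r j = r k" using r(1) d by (simp add: meet_at_iff)
  \<comment> \<open>The pair meets in \<open>r\<close>, so the spectator part carries the whole
    nonzero norm of \<open>r\<close> and can be cancelled below.\<close>
  have "spectator_part m i j k r \<noteq> 0"
    using r(2) rel_norm2_decompose[OF d, of m r] rjk mjk by auto
  moreover have "of_real (m j + m k) * rel_form m r v' = of_real (m j + m k) * rel_form m r v"
    using w(1) rel_form_translate[of v' w "v i - w i" m r] by (simp add: v'_def)
  ultimately have sp: "spectator_part m i j k v' = spectator_part m i j k v"
    unfolding rel_form_decompose[OF d] using rjk pos[of i] by simp
  have "(m j + m k) * rel_norm2 m v' = (m j + m k) * rel_norm2 m v"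
    using w(2) rel_norm2_translate[of v' w "v i - w i" m] by (simp add: v'_def)
  then have "m j * m k * total_mass m * (cmod (v' j - v' k))\<^sup>2 = m j * m k * total_mass m * (cmod (v j - v k))\<^sup>2"
    unfolding rel_norm2_decompose[OF d] sp by simp
  moreover have "m j * m k * total_mass m \<noteq> 0"
    using pos[of P1] pos[of P2] pos[of P3] pos[of j] pos[of k] by (simp add: total_mass_def)
  ultimately have n: "cmod (v' j - v' k) = cmod (v j - v k)"
    by simp
  have vi: "v' i = v i" by (simp add: v'_def)
  have mom: "of_real (m j) * v' j + of_real (m k) * v' k = of_real (m j) * v j + of_real (m k) * v k"
    using sp vi by (simp add: spectator_part_def algebra_simps)
  have "scatter m i ((v' j - v' k) / (v j - v k)) v v'"
    unfolding scatter_iff[OF d] mom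
    using vjk n vi by (simp add: norm_divide)
  then show ?thesis
    by (rule that) (simp add: v'_def)
qed

lemma coll_angle_bounds:
  shows "0 < coll_angle m k" "coll_angle m k < pi / 2"
  using pos[of P1] pos[of P2] pos[of P3] pos[of k]
  unfolding coll_angle_def by (simp_all only: arctan_ubound) (simp add: total_mass_def)

text \<open>Follows from the secant identity and
  \<open>(m i + m k) * (m j + m k) = m i * m j + m k * total_mass m\<close>.\<close>

lemma cos_coll_angle:
  assumes d: "distinct [i, j, k]"
  shows "(cos (coll_angle m k))\<^sup>2 * ((m i + m k) * (m j + m k)) = m i * m j"
proof -
  have p: "m i > 0" "m j > 0" "m k > 0" "m i + m j + m k > 0"
    using pos[of i] pos[of j] pos[of k] by auto
  have "(tan (coll_angle m k))\<^sup>2 = (m k)\<^sup>2 * (total_mass m / (m i * m j * m k))"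
  proof -
    have "m P1 * m P2 * m P3 = m i * m j * m k"
      using d by (cases i; cases j; cases k) auto
    then show ?thesis using p
      by (simp add: tan_coll_angle power_mult_distrib total_mass_eq[OF d])
  qed
  also have "\<dots> = (m i + m j + m k) * m k / (m i * m j)"
    using p by (simp add: total_mass_eq[OF d] power2_eq_square field_simps)
  finally have t: "(tan (coll_angle m k))\<^sup>2 = (m i + m j + m k) * m k / (m i * m j)" .
  have "cos (coll_angle m k) \<noteq> 0"
    using coll_angle_bounds[of k] cos_gt_zero by (metis less_irrefl)
  then have "1 + (tan (coll_angle m k))\<^sup>2 = inverse ((cos (coll_angle m k))\<^sup>2)"
    using tan_sec[of "coll_angle m k"] by (simp add: power_inverse)
  then have "inverse ((cos (coll_angle m k))\<^sup>2) = ((m i + m k) * (m j + m k)) / (m i * m j)"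
    unfolding t using p by (simp add: field_simps)
  then have "(cos (coll_angle m k))\<^sup>2 = (m i * m j) / ((m i + m k) * (m j + m k))"
    by (metis inverse_divide inverse_inverse_eq)
  then show ?thesis using p by simp
qed

text \<open>The tangents are \<open>m p * \<mu>\<close> with
  \<open>\<mu>\<^sup>2 * (m P1 * m P2 * m P3)\<close> equal to the total mass, so their sum equals
  their product. This is \<open>sin (A + B + C) = 0\<close>, and acute angles leave only the value
  pi.\<close>

lemma sum_coll_angle:
  shows "coll_angle m P1 + coll_angle m P2 + coll_angle m P3 = pi"
proof -
  define A B C where "A = coll_angle m P1" and "B = coll_angle m P2" and "C = coll_angle m P3"
  note D = A_def B_def C_def
  define \<mu> where "\<mu> = sqrt (total_mass m / (m P1 * m P2 * m P3))"
  have p: "m P1 > 0" "m P2 > 0" "m P3 > 0" using pos by auto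
  have b: "0 < A" "A < pi / 2" "0 < B" "B < pi / 2" "0 < C" "C < pi / 2"
    using coll_angle_bounds by (auto simp: D)
  then have c: "cos A > 0" "cos B > 0" "cos C > 0" using cos_gt_zero by auto
  have "sin x = y * cos x" if "tan x = y" "cos x > 0" for x y :: real
    using that by (auto simp: tan_def)
  then have s: "sin A = m P1 * \<mu> * cos A" "sin B = m P2 * \<mu> * cos B" "sin C = m P3 * \<mu> * cos C"
    using c tan_coll_angle[of m] by (simp_all add: D \<mu>_def)
  have mu: "\<mu>\<^sup>2 * (m P1 * m P2 * m P3) = m P1 + m P2 + m P3"
    using p by (simp add: \<mu>_def total_mass_def)
  have "sin (A + B + C) =
     cos A * cos B * cos C * \<mu> * (m P1 + m P2 + m P3 - \<mu>\<^sup>2 * (m P1 * m P2 * m P3))"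
    unfolding sin_add cos_add s by (simp add: power2_eq_square) algebra
  then have z: "sin (A + B + C) = 0" using mu by simp
  have "A + B + C = pi"
  proof (rule ccontr)
    assume ne: "A + B + C \<noteq> pi"
    have "sin (A + B + C) \<noteq> 0"
    proof (cases "A + B + C < pi")
      case True
      then show ?thesis using sin_gt_zero[of "A + B + C"] b by simp
    next
      case False
      then show ?thesis using sin_lt_zero[of "A + B + C"] b ne by simp
    qed
    then show False using z by simp
  qed
  then show ?thesis by (simp add: D)
qed

lemma rel_form_meet:
  assumes d: "distinct [i, j, k]" and r: "meet_at i r" and w: "meet_at j w"
  shows "rel_form m r w = of_real (m i * m j) * (r i - r j) * cnj (w i - w j)"
proof -
  have "r j = r k" "w i = w k"
    using r w d meet_at_iff[of i j k] meet_at_iff[of j i k] by auto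
  then show ?thesis
    by (simp add: rel_form_perm[OF d])
qed

lemma rel_norm2_meet:
  assumes d: "distinct [i, j, k]" and r: "meet_at i r"
  shows "rel_norm2 m r = m i * (m j + m k) * (cmod (r i - r j))\<^sup>2"
proof -
  have "r j = r k"
    using r d meet_at_iff[of i j k] by auto
  then have "complex_of_real (rel_norm2 m r) = of_real (m i * (m j + m k) * (cmod (r i - r j))\<^sup>2)"
    unfolding rel_form_self[symmetric] of_real_mult of_real_add complex_norm_square
    by (simp add: rel_form_perm[OF d] algebra_simps)
  then show ?thesis
    using of_real_eq_iff by blast
qed

text \<open>L_i and L_j are complex lines, so this ratio does not depend on the vectors chosen on
  them. It is applied to positions and velocities alike.\<close>

lemma rel_form_meet_cos:
  assumes d: "distinct [i, j, k]" and r: "meet_at i r" and w: "meet_at j w"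
  shows "(cmod (rel_form m r w))\<^sup>2 = (cos (coll_angle m k))\<^sup>2 * (rel_norm2 m r * rel_norm2 m w)"
proof -
  have d': "distinct [j, i, k]" using d by auto
  have "rel_norm2 m r * rel_norm2 m w =
    (m i * m j * (cmod (r i - r j))\<^sup>2 * (cmod (w i - w j))\<^sup>2) * ((m i + m k) * (m j + m k))"
    unfolding rel_norm2_meet[OF d r] rel_norm2_meet[OF d' w]
    by (simp add: norm_minus_commute)
  then have "(cos (coll_angle m k))\<^sup>2 * (rel_norm2 m r * rel_norm2 m w) =
    (m i * m j * (cmod (r i - r j))\<^sup>2 * (cmod (w i - w j))\<^sup>2) *
    ((cos (coll_angle m k))\<^sup>2 * ((m i + m k) * (m j + m k)))"
    by (simp only: ac_simps)
  also have "\<dots> = (m i * m j * (cmod (r i - r j))\<^sup>2 * (cmod (w i - w j))\<^sup>2) * (m i * m j)"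
    by (simp only: cos_coll_angle[OF d])
  also have "\<dots> = (cmod (rel_form m r w))\<^sup>2"
    using pos[of i] pos[of j]
    by (simp add: rel_form_meet[OF d r w] norm_mult power2_eq_square del: complex_cnj_diff)
  finally show ?thesis by simp
qed

text \<open>A nonzero vector on L_i is never orthogonal to L_j, so its product with a vector on L_j
  can be prescribed.\<close>

lemma meet_target:
  assumes "i \<noteq> j" and r: "meet_at i r" "rel_norm2 m r \<noteq> 0"
  obtains w where "meet_at j w" "rel_form m r w = z" "\<And>p. p \<noteq> j \<Longrightarrow> w p = 0"
proof -
  define k where "k = third i j"
  have d: "distinct [i, j, k]" "distinct [j, i, k]"
    using distinct_third[OF \<open>i \<noteq> j\<close>] by (auto simp: k_def)
  define w where "w = (\<lambda>p. if p = j then - cnj (z / (of_real (m i * m j) * (r i - r j))) else 0)"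
  have w: "meet_at j w"
    using d by (auto simp: meet_at_iff w_def)
  have "r i \<noteq> r j"
    using r(2) rel_norm2_meet[OF d(1) r(1)] by auto
  then have "rel_form m r w = z"
    using rel_form_meet[OF d(1) r(1) w] pos[of i] pos[of j] d by (simp add: w_def)
  then show ?thesis
    by (rule that[OF w]) (simp add: w_def)
qed

end

subsection \<open>Turning angles of a collision sequence\<close>

lemma one_plus_tan2: "cos u \<noteq> 0 \<Longrightarrow> (cos u)\<^sup>2 * (1 + (tan u)\<^sup>2) = (1::real)"
  by (simp add: tan_def field_simps)

lemma sin_diff_tan:
  assumes "cos u \<noteq> 0" "cos w \<noteq> (0::real)"
  shows "(sin (w - u))\<^sup>2 * ((1 + (tan u)\<^sup>2) * (1 + (tan w)\<^sup>2)) = (tan w - tan u)\<^sup>2"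
proof -
  have "sin (w - u) = cos u * cos w * (tan w - tan u)"
    using assms by (simp add: sin_diff tan_def field_simps)
  then have "(sin (w - u))\<^sup>2 * ((1 + (tan u)\<^sup>2) * (1 + (tan w)\<^sup>2)) =
      ((cos u)\<^sup>2 * (1 + (tan u)\<^sup>2)) * ((cos w)\<^sup>2 * (1 + (tan w)\<^sup>2)) * (tan w - tan u)\<^sup>2"
    by (simp add: power_mult_distrib)
  then show ?thesis
    using assms by (simp add: one_plus_tan2)
qed

text \<open>The chain starts on L_i, visits the lines of the list and is closed by L_3, where the
  final velocity lies when particles 1 and 2 move together; hence the entry for the empty
  list.\<close>

fun edge_angles :: "(particle \<Rightarrow> real) \<Rightarrow> particle \<Rightarrow> particle list \<Rightarrow> real list" where
  "edge_angles m i [] = [coll_angle m (third i P3)]"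
| "edge_angles m i (j # s) = coll_angle m (third i j) # edge_angles m j s"

definition turn :: "real \<Rightarrow> real \<Rightarrow> real \<Rightarrow> bool" where
  "turn \<kappa> d \<phi> \<longleftrightarrow> 0 < d \<and> \<kappa> * sin d = sin \<phi>"

lemma turns_sum_pos: "list_all2 (turn \<kappa>) ds es \<Longrightarrow> sum_list ds \<ge> 0"
  by (induction rule: list_all2_induct) (auto simp: turn_def)

lemma edge_angles_not_Nil: "edge_angles m i s \<noteq> []"
  by (cases s) auto

lemma turns_edges_sum_pos:
  assumes "list_all2 (turn \<kappa>) ds (edge_angles m i s)"
  shows "sum_list ds > 0"
proof (cases ds)
  case Nil
  then show ?thesis using assms edge_angles_not_Nil by auto
next
  case (Cons d ds')
  then obtain e es where "edge_angles m i s = e # es" "turn \<kappa> d e" "list_all2 (turn \<kappa>) ds' es"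
    using assms by (cases "edge_angles m i s") auto
  then show ?thesis
    using turns_sum_pos[of \<kappa> ds' es] Cons by (auto simp: turn_def)
qed

text \<open>The constant K of the motion. With W the real part of the product, |r|^2 |v|^2 = K +
  W^2, which suggests W = sqrt K tan u.\<close>

definition energy_excess :: "(particle \<Rightarrow> real) \<Rightarrow> (particle \<Rightarrow> complex) \<Rightarrow> (particle \<Rightarrow> complex) \<Rightarrow> real" where
  "energy_excess m r v = rel_norm2 m r * rel_norm2 m v - (Re (rel_form m r v))\<^sup>2"

lemma energy_excess_free:
  "energy_excess m (\<lambda>p. r p + of_real t * v p) v = energy_excess m r v"
  unfolding energy_excess_def rel_norm2_add rel_form_add_left rel_form_self
  by (simp add: power2_eq_square algebra_simps)

lemma turnI:
  assumes "0 < d" "d < pi" "0 < \<phi>" "\<phi> < pi" "\<kappa> \<ge> 0" "(\<kappa> * sin d)\<^sup>2 = (sin \<phi>)\<^sup>2"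
  shows "turn \<kappa> d \<phi>"
proof -
  have "\<kappa> * sin d \<ge> 0" "sin \<phi> \<ge> 0"
    using assms by (auto intro!: mult_nonneg_nonneg sin_ge_zero)
  then have "\<kappa> * sin d = sin \<phi>"
    using assms(6) power2_eq_iff_nonneg by blast
  then show ?thesis using assms(1) by (simp add: turn_def)
qed

text \<open>The hypothesis \<open>eq\<close> is the relation of \<open>rel_form_meet_cos\<close>
  between two successive collision points, multiplied by the fourth power of the speed. Dividing by
  K^2 leaves tangents only, and \<open>sin_diff_tan\<close> brings in the sine of the
  difference.\<close>

lemma turn_between:
  fixes K W W' I \<phi> :: real
  assumes K: "I\<^sup>2 < K" and W: "W < W'" and \<phi>: "0 < \<phi>" "\<phi> < pi"
    and eq: "(cos \<phi>)\<^sup>2 * ((K + W\<^sup>2) * (K + W'\<^sup>2)) = (K + W * W')\<^sup>2 + (W' - W)\<^sup>2 * I\<^sup>2"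
  shows "turn (sqrt (1 - I\<^sup>2 / K)) (arctan (W' / sqrt K) - arctan (W / sqrt K)) \<phi>"
proof -
  have K0: "K > 0" using K zero_le_power2[of I] by linarith
  define a b j where "a = W / sqrt K" and "b = W' / sqrt K" and "j = I\<^sup>2 / K"
  have W_eq: "W = sqrt K * a" "W' = sqrt K * b" "I\<^sup>2 = K * j"
    using K0 by (simp_all add: a_def b_def j_def)
  have j: "j \<le> 1" using K K0 by (simp add: j_def)
  have sq: "sqrt K * sqrt K = K" using K0 by simp
  have "K\<^sup>2 * ((cos \<phi>)\<^sup>2 * ((1 + a\<^sup>2) * (1 + b\<^sup>2))) = K\<^sup>2 * ((1 + a * b)\<^sup>2 + (b - a)\<^sup>2 * j)"
  proof -
    have "W\<^sup>2 = K * a\<^sup>2" "W'\<^sup>2 = K * b\<^sup>2" "W * W' = K * (a * b)" "(W' - W)\<^sup>2 = K * (b - a)\<^sup>2"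
      using K0 by (simp_all add: W_eq power_mult_distrib right_diff_distrib[symmetric])
    then show ?thesis
      using eq unfolding \<open>I\<^sup>2 = K * j\<close> by (simp add: power2_eq_square algebra_simps)
  qed
  then have "(cos \<phi>)\<^sup>2 * ((1 + a\<^sup>2) * (1 + b\<^sup>2)) = (1 + a * b)\<^sup>2 + (b - a)\<^sup>2 * j"
    using K0 by simp
  then have "(sin \<phi>)\<^sup>2 * ((1 + a\<^sup>2) * (1 + b\<^sup>2)) = (1 - j) * (b - a)\<^sup>2"
    unfolding cos_squared_eq by (simp add: power2_eq_square algebra_simps)
  also have "\<dots> = (1 - j) * (sin (arctan b - arctan a))\<^sup>2 * ((1 + a\<^sup>2) * (1 + b\<^sup>2))"
    using sin_diff_tan[of "arctan a" "arctan b"] by (simp add: tan_arctan)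
  finally have "(sin \<phi>)\<^sup>2 = (1 - j) * (sin (arctan b - arctan a))\<^sup>2"
    using add_pos_nonneg[OF zero_less_one zero_le_power2[of a]]
      add_pos_nonneg[OF zero_less_one zero_le_power2[of b]] by auto
  then have "(sqrt (1 - j) * sin (arctan b - arctan a))\<^sup>2 = (sin \<phi>)\<^sup>2"
    using j by (simp add: power_mult_distrib)
  moreover have "arctan a < arctan b"
    using W K0 by (simp add: a_def b_def arctan_less_iff divide_strict_right_mono)
  moreover have "arctan b - arctan a < pi"
    using arctan_ubound[of b] arctan_lbound[of a] by linarith
  ultimately show ?thesis
    unfolding a_def[symmetric] b_def[symmetric] j_def[symmetric]
    using \<phi> j by (intro turnI) auto
qed

text \<open>The limit of \<open>turn_between\<close> as one end goes to infinity: that collision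
  point is replaced by the velocity, whose line is approached at u = pi / 2 or u = -pi / 2.\<close>

lemma turn_infinity:
  fixes K W I \<phi> :: real
  assumes K: "I\<^sup>2 < K" and \<phi>: "0 < \<phi>" "\<phi> < pi"
    and eq: "(cos \<phi>)\<^sup>2 * (K + W\<^sup>2) = W\<^sup>2 + I\<^sup>2"
  shows "turn (sqrt (1 - I\<^sup>2 / K)) (pi / 2 - arctan (W / sqrt K)) \<phi>"
    and "turn (sqrt (1 - I\<^sup>2 / K)) (arctan (W / sqrt K) + pi / 2) \<phi>"
proof -
  have K0: "K > 0" using K zero_le_power2[of I] by linarith
  define a j where "a = W / sqrt K" and "j = I\<^sup>2 / K"
  have W_eq: "W\<^sup>2 = K * a\<^sup>2" "I\<^sup>2 = K * j"
    using K0 by (simp_all add: a_def j_def power_divide)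
  have j: "j \<le> 1" using K K0 by (simp add: j_def)
  have "K * ((cos \<phi>)\<^sup>2 * (1 + a\<^sup>2)) = K * (a\<^sup>2 + j)"
    using eq unfolding W_eq by (simp add: algebra_simps)
  then have "(cos \<phi>)\<^sup>2 * (1 + a\<^sup>2) = a\<^sup>2 + j"
    using K0 by simp
  then have "(sin \<phi>)\<^sup>2 * (1 + a\<^sup>2) = 1 - j"
    unfolding cos_squared_eq by (simp add: algebra_simps)
  then have "(sin \<phi>)\<^sup>2 * ((cos (arctan a))\<^sup>2 * (1 + a\<^sup>2)) = (1 - j) * (cos (arctan a))\<^sup>2"
    by (simp add: ac_simps)
  moreover have "(cos (arctan a))\<^sup>2 * (1 + a\<^sup>2) = 1"
    using one_plus_tan2[of "arctan a"] by (simp add: tan_arctan)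
  ultimately have "(sin \<phi>)\<^sup>2 = (1 - j) * (cos (arctan a))\<^sup>2"
    by simp
  then have *: "(sqrt (1 - j) * cos (arctan a))\<^sup>2 = (sin \<phi>)\<^sup>2"
    using j by (simp add: power_mult_distrib)
  have q: "0 \<le> sqrt (1 - j)" using j by simp
  have s: "sin (pi / 2 - arctan a) = cos (arctan a)" "sin (arctan a + pi / 2) = cos (arctan a)"
    by (simp_all add: sin_diff sin_add)
  show "turn (sqrt (1 - I\<^sup>2 / K)) (pi / 2 - arctan (W / sqrt K)) \<phi>"
    unfolding a_def[symmetric] j_def[symmetric]
    using \<phi> q * arctan_ubound[of a] arctan_lbound[of a] by (intro turnI) (auto simp only: s)
  show "turn (sqrt (1 - I\<^sup>2 / K)) (arctan (W / sqrt K) + pi / 2) \<phi>"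
    unfolding a_def[symmetric] j_def[symmetric]
    using \<phi> q * arctan_ubound[of a] arctan_lbound[of a] by (intro turnI) (auto simp only: s)
qed

context three_masses
begin

lemma coll_angle_pi: "coll_angle m k < pi"
  using coll_angle_bounds[of k] pi_gt_zero by linarith

text \<open>Here \<open>r\<close> is a collision point on L_i and \<open>v\<close> the velocity just
  after it. Each leg advances u = arctan (W / sqrt K) by its turn while I and K persist, so the
  turns telescope; the last velocity lies on L_3, and that leg runs up to u = pi / 2.\<close>

lemma evolves_turns:
  assumes "evolves m r v s r' v'"
    and "meet_at i r" "v' P1 = v' P2" "distinct_adj (i # s @ [P3])"
    and "(Im (rel_form m r v))\<^sup>2 < energy_excess m r v"
  shows "\<exists>ds. list_all2 (turn (sqrt (1 - (Im (rel_form m r v))\<^sup>2 / energy_excess m r v))) ds (edge_angles m i s)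
           \<and> sum_list ds = pi / 2 - arctan (Re (rel_form m r v) / sqrt (energy_excess m r v))"
  using assms
proof (induction arbitrary: i)
  case (no_collision r v)
  define W I K where "W = Re (rel_form m r v)" and "I = Im (rel_form m r v)" and "K = energy_excess m r v"
  have d: "distinct [i, P3, third i P3]"
    using no_collision by (intro distinct_third) auto
  have "meet_at P3 v"
    using no_collision(2) meet_at_iff[of P3 P1 P2 v] by simp
  from rel_form_meet_cos[OF d no_collision(1) this]
  have "(cos (coll_angle m (third i P3)))\<^sup>2 * (K + W\<^sup>2) = W\<^sup>2 + I\<^sup>2"
    by (simp add: cmod_power2 W_def I_def K_def energy_excess_def)
  then have "turn (sqrt (1 - I\<^sup>2 / K)) (pi / 2 - arctan (W / sqrt K)) (coll_angle m (third i P3))"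
    using no_collision coll_angle_bounds coll_angle_pi
    by (intro turn_infinity) (auto simp: W_def I_def K_def)
  then show ?case
    by (intro exI[of _ "[pi / 2 - arctan (W / sqrt K)]"]) (simp add: W_def I_def K_def)
next
  case (collision t r1 r v j x v1 s r2 v2)
  define W I K where "W = Re (rel_form m r v)" and "I = Im (rel_form m r v)" and "K = energy_excess m r v"
  define W' where "W' = Re (rel_form m r1 v)"
  have K: "I\<^sup>2 < K" using collision.prems by (simp add: I_def K_def)
  then have K0: "K > 0" using zero_le_power2[of I] by linarith
  have r1: "rel_form m r1 v = rel_form m r v + of_real (t * rel_norm2 m v)"
    by (simp add: collision(2) rel_form_add_left rel_form_self)
  have K1: "energy_excess m r1 v = K"
    by (simp add: K_def collision(2) energy_excess_free)
  have f: "rel_form m r1 v1 = rel_form m r1 v" and n: "rel_norm2 m v1 = rel_norm2 m v"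
    using collision by (simp_all add: rel_form_scatter rel_norm2_scatter)
  have K2: "energy_excess m r1 v1 = K"
    using K1 by (simp add: energy_excess_def f n)
  have I1: "Im (rel_form m r1 v) = I" and W': "W' = W + t * rel_norm2 m v"
    by (simp_all add: r1 I_def W'_def W_def)
  have E: "rel_norm2 m v > 0" and N: "rel_norm2 m r > 0"
    using K0 rel_norm2_nonneg[of r] rel_norm2_nonneg[of v] zero_le_power2[of W]
    unfolding K_def energy_excess_def W_def[symmetric]
    by (metis diff_gt_0_iff_gt less_eq_real_def linorder_not_less mult_zero_left mult_zero_right)+
  have "\<exists>ds. list_all2 (turn (sqrt (1 - (Im (rel_form m r1 v1))\<^sup>2 / energy_excess m r1 v1))) ds (edge_angles m j s)
           \<and> sum_list ds = pi / 2 - arctan (Re (rel_form m r1 v1) / sqrt (energy_excess m r1 v1))"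
    using collision.prems collision(3) K by (intro collision.IH) (auto simp: f I1 K2)
  then obtain ds where ds: "list_all2 (turn (sqrt (1 - I\<^sup>2 / K))) ds (edge_angles m j s)"
      "sum_list ds = pi / 2 - arctan (W' / sqrt K)"
    unfolding f K2 I1 W'_def[symmetric] by blast
  have d: "distinct [i, j, third i j]"
    using collision.prems by (intro distinct_third) auto
  define e where "e = coll_angle m (third i j)"
  have c: "(cmod (rel_form m r r1))\<^sup>2 = (cos e)\<^sup>2 * (rel_norm2 m r * rel_norm2 m r1)"
    unfolding e_def using collision by (intro rel_form_meet_cos[OF d]) auto
  have g: "rel_norm2 m v * rel_norm2 m r = K + W\<^sup>2" "rel_norm2 m v * rel_norm2 m r1 = K + W'\<^sup>2"
    using K1 by (simp_all add: K_def W_def W'_def energy_excess_def mult.commute)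
  have rr1: "rel_form m r r1 = of_real (rel_norm2 m r) + of_real t * rel_form m r v"
    by (simp add: collision(2) rel_form_add_right rel_form_self)
  \<comment> \<open>Scaling by the squared speed expresses the product of the two collision points
    through W, W', I and K alone.\<close>
  have "rel_norm2 m v * Re (rel_form m r r1) = K + W * W'" "rel_norm2 m v * Im (rel_form m r r1) = (W' - W) * I"
    using g(1) by (simp_all add: rr1 W' W_def[symmetric] I_def[symmetric] algebra_simps power2_eq_square)
  then have "(K + W * W')\<^sup>2 + (W' - W)\<^sup>2 * I\<^sup>2 = (rel_norm2 m v)\<^sup>2 * (cmod (rel_form m r r1))\<^sup>2"
    unfolding cmod_power2 by (metis distrib_left power_mult_distrib)
  also have "\<dots> = (cos e)\<^sup>2 * ((K + W\<^sup>2) * (K + W'\<^sup>2))"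
    unfolding c g[symmetric] by (simp add: power2_eq_square)
  finally have "turn (sqrt (1 - I\<^sup>2 / K)) (arctan (W' / sqrt K) - arctan (W / sqrt K)) e"
    using K W' E \<open>t > 0\<close> coll_angle_bounds coll_angle_pi
    by (intro turn_between) (auto simp: e_def)
  then show ?case
    using ds unfolding W_def[symmetric] I_def[symmetric] K_def[symmetric]
    by (intro exI[of _ "(arctan (W' / sqrt K) - arctan (W / sqrt K)) # ds"]) (simp add: e_def)
qed

text \<open>Particles 2 and 3 rest, so the incoming velocity lies on L_1 and the first leg comes
  from u = -pi / 2; its turn completes those of \<open>evolves_turns\<close> to pi.\<close>

lemma capture_process_turns:
  assumes "capture_process m s" "distinct_adj (P1 # s @ [P3])" "s \<noteq> []"
  shows "\<exists>\<kappa> ds. 0 < \<kappa> \<and> \<kappa> \<le> 1 \<and> list_all2 (turn \<kappa>) ds (edge_angles m P1 s) \<and> sum_list ds = pi"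
proof -
  obtain r v r' v' where v: "v P2 = 0" "v P3 = 0" "v P1 \<noteq> 0" and r: "r P2 \<noteq> r P3"
    and ev: "evolves m r v s r' v'" and v': "v' P1 = v' P2"
    using assms(1) unfolding capture_process_def by blast
  obtain i s' where s: "s = i # s'" using assms(3) by (cases s) auto
  from ev obtain t r1 x v1 where t: "t > 0" and r1: "r1 = (\<lambda>p. r p + complex_of_real t * v p)"
    and m1: "meet_at i r1" and sc: "scatter m i x v v1" and ev1: "evolves m r1 v1 s' r' v'"
    unfolding s by (cases rule: evolves.cases) auto
  have d: "distinct [P1, i, third P1 i]"
    using assms(2) s by (intro distinct_third) auto
  have mv: "meet_at P1 v" using v meet_at_iff[of P1 P2 P3 v] by simp
  have f: "rel_form m r1 v1 = rel_form m r1 v" and n: "rel_norm2 m v1 = rel_norm2 m v"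
    using m1 sc by (simp_all add: rel_form_scatter rel_norm2_scatter)
  define e where "e = coll_angle m (third P1 i)"
  have e: "0 < e" "e < pi" using coll_angle_bounds coll_angle_pi by (auto simp: e_def)
  define W I K where "W = Re (rel_form m r1 v1)" and "I = Im (rel_form m r1 v1)" and "K = energy_excess m r1 v1"
  have "rel_form m v r1 = cnj (rel_form m r1 v1)"
    by (simp add: f cnj_rel_form)
  then have "(cmod (rel_form m r1 v1))\<^sup>2 = (cos e)\<^sup>2 * (rel_norm2 m r1 * rel_norm2 m v1)"
    using rel_form_meet_cos[OF d mv m1] by (simp add: n e_def)
  then have eq: "(cos e)\<^sup>2 * (K + W\<^sup>2) = W\<^sup>2 + I\<^sup>2"
    by (simp add: cmod_power2 W_def I_def K_def energy_excess_def)
  have "r1 P2 \<noteq> r1 P3" using r v by (simp add: r1)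
  then have "rel_norm2 m r1 > 0"
    unfolding rel_norm2_def
    by (intro add_nonneg_pos add_pos_nonneg mult_pos_pos mult_nonneg_nonneg) (auto simp: pos less_imp_le)
  moreover have "rel_norm2 m v > 0"
    unfolding rel_norm2_def using v
    by (intro add_nonneg_pos add_pos_nonneg mult_pos_pos mult_nonneg_nonneg) (auto simp: pos less_imp_le)
  ultimately have "K + W\<^sup>2 > 0"
    by (simp add: K_def energy_excess_def W_def n)
  moreover have "sin e > 0" using e sin_gt_zero by blast
  \<comment> \<open>By \<open>eq\<close> this positive quantity equals \<open>K - I\<^sup>2\<close>,
    which makes \<kappa> positive.\<close>
  ultimately have "(sin e)\<^sup>2 * (K + W\<^sup>2) > 0" by simp
  then have IK: "I\<^sup>2 < K" using eq unfolding cos_squared_eq by (simp add: algebra_simps)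
  then have K0: "K > 0" using zero_le_power2[of I] by linarith
  obtain ds where ds: "list_all2 (turn (sqrt (1 - I\<^sup>2 / K))) ds (edge_angles m i s')"
      "sum_list ds = pi / 2 - arctan (W / sqrt K)"
    using evolves_turns[OF ev1 m1 v'] IK assms(2) unfolding s I_def K_def W_def by auto
  have "turn (sqrt (1 - I\<^sup>2 / K)) (arctan (W / sqrt K) + pi / 2) e"
    by (rule turn_infinity(2)[OF IK e eq])
  then have "list_all2 (turn (sqrt (1 - I\<^sup>2 / K))) ((arctan (W / sqrt K) + pi / 2) # ds) (edge_angles m P1 s)
      \<and> sum_list ((arctan (W / sqrt K) + pi / 2) # ds) = pi"
    using ds by (simp add: s e_def)
  moreover have "0 < sqrt (1 - I\<^sup>2 / K)" "sqrt (1 - I\<^sup>2 / K) \<le> 1"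
    using IK K0 by auto
  ultimately show ?thesis by blast
qed

end

subsection \<open>Realizing turning angles\<close>

text \<open>Motions are rebuilt with speed 1 and K = 1: the product is tan u + i J with J^2 = 1 -
  \<kappa>^2. On a leg to or from infinity, the angle relation and the turn relation then fix the
  one norm still open.\<close>

lemma norm2_from_infinity:
  fixes n u e \<kappa> :: real
  assumes "cos u > 0" "cos e > 0" "\<kappa> * cos u = sin e"
    and "(cos e)\<^sup>2 * ((1 + (tan u)\<^sup>2) * n) = (tan u)\<^sup>2 + (1 - \<kappa>\<^sup>2)"
  shows "n = 1"
proof -
  have "(cos e)\<^sup>2 * (1 + (tan u)\<^sup>2) = (1 - \<kappa>\<^sup>2 * (cos u)\<^sup>2) * (1 + (tan u)\<^sup>2)"
    unfolding cos_squared_eq[of e] assms(3)[symmetric] by (simp add: power_mult_distrib)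
  also have "\<dots> = (1 + (tan u)\<^sup>2) - \<kappa>\<^sup>2 * ((cos u)\<^sup>2 * (1 + (tan u)\<^sup>2))"
    by (simp add: algebra_simps)
  also have "\<dots> = (tan u)\<^sup>2 + (1 - \<kappa>\<^sup>2)"
    using assms(1) by (simp add: one_plus_tan2)
  finally have *: "(cos e)\<^sup>2 * (1 + (tan u)\<^sup>2) = (tan u)\<^sup>2 + (1 - \<kappa>\<^sup>2)" .
  have "(cos e)\<^sup>2 * (1 + (tan u)\<^sup>2) * n = (cos e)\<^sup>2 * (1 + (tan u)\<^sup>2) * 1"
    using assms(4) unfolding * mult.assoc[symmetric] by simp
  moreover have "(cos e)\<^sup>2 * (1 + (tan u)\<^sup>2) \<noteq> 0"
    using assms(2) zero_le_power2[of "tan u"]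
    by (metis add_pos_nonneg less_irrefl mult_pos_pos zero_less_one zero_less_power)
  ultimately show ?thesis
    using mult_left_cancel by blast
qed

text \<open>The finite counterpart: a next collision point chosen by its product with the current
  one has the norm that speed 1 and K = 1 demand.\<close>

lemma norm2_from_turn:
  fixes n u w e \<kappa> :: real
  assumes "cos u > 0" "cos w > 0" "cos e > 0" "\<kappa> * sin (w - u) = sin e"
    and "(cos e)\<^sup>2 * ((1 + (tan u)\<^sup>2) * n) =
      (1 + tan u * tan w)\<^sup>2 + (tan w - tan u)\<^sup>2 * (1 - \<kappa>\<^sup>2)"
  shows "n = 1 + (tan w)\<^sup>2"
proof -
  have "(cos e)\<^sup>2 * ((1 + (tan u)\<^sup>2) * (1 + (tan w)\<^sup>2)) =
      (1 - \<kappa>\<^sup>2 * (sin (w - u))\<^sup>2) * ((1 + (tan u)\<^sup>2) * (1 + (tan w)\<^sup>2))"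
    unfolding cos_squared_eq[of e] assms(4)[symmetric] by (simp add: power_mult_distrib)
  also have "\<dots> = (1 + (tan u)\<^sup>2) * (1 + (tan w)\<^sup>2) -
      \<kappa>\<^sup>2 * ((sin (w - u))\<^sup>2 * ((1 + (tan u)\<^sup>2) * (1 + (tan w)\<^sup>2)))"
    by (simp add: algebra_simps)
  also have "\<dots> = (1 + (tan u)\<^sup>2) * (1 + (tan w)\<^sup>2) - \<kappa>\<^sup>2 * (tan w - tan u)\<^sup>2"
    using assms(1,2) by (simp add: sin_diff_tan)
  also have "\<dots> = (1 + tan u * tan w)\<^sup>2 + (tan w - tan u)\<^sup>2 * (1 - \<kappa>\<^sup>2)"
    by (simp add: power2_eq_square algebra_simps)
  finally have "(cos e)\<^sup>2 * (1 + (tan u)\<^sup>2) * n = (cos e)\<^sup>2 * (1 + (tan u)\<^sup>2) * (1 + (tan w)\<^sup>2)"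
    using assms(5) by (simp add: mult.assoc)
  moreover have "(cos e)\<^sup>2 * (1 + (tan u)\<^sup>2) \<noteq> 0"
    using assms(3) zero_le_power2[of "tan u"]
    by (metis add_pos_nonneg less_irrefl mult_pos_pos zero_less_one zero_less_power)
  ultimately show ?thesis
    using mult_left_cancel by blast
qed

lemma meet_at_translate: "(\<And>p. w p = v p + c) \<Longrightarrow> meet_at i w \<longleftrightarrow> meet_at i v"
  by (simp add: meet_at_def)

context three_masses
begin

lemma cos_coll_angle_pos: "cos (coll_angle m k) > 0"
  using coll_angle_bounds[of k] cos_gt_zero by blast

lemma meet_two_norm2:
  assumes "i \<noteq> j" "meet_at i r" "meet_at j r"
  shows "rel_norm2 m r = 0"
proof -
  have d: "distinct [i, j, third i j]" "distinct [j, i, third i j]"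
    using distinct_third[OF assms(1)] by auto
  have "r j = r (third i j)" "r i = r (third i j)"
    using assms d meet_at_iff[of i j "third i j" r] meet_at_iff[of j i "third i j" r] by auto
  then show ?thesis
    using rel_norm2_meet[OF d(1) assms(2)] by simp
qed

text \<open>Converse of \<open>evolves_turns\<close> under the normalization; here \<open>v\<close>
  is the velocity before the collision at \<open>r\<close>. For each leg the next point is chosen on
  its line by its product with \<open>r\<close>, the velocity leading there is read off, and
  \<open>scatter_to\<close> produces it.\<close>

lemma turns_evolves:
  assumes "list_all2 (turn \<kappa>) ds (edge_angles m i s)" "sum_list ds = pi / 2 - u" "- (pi / 2) < u"
    and "meet_at i r" "\<not> meet_at i v" "rel_norm2 m v = 1"
    and "rel_form m r v = Complex (tan u) J" "rel_norm2 m r = 1 + (tan u)\<^sup>2"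
    and "distinct_adj (i # s @ [P3])" "J\<^sup>2 = 1 - \<kappa>\<^sup>2"
  shows "\<exists>x v1 r2 v2. scatter m i x v v1 \<and> evolves m r v1 s r2 v2 \<and> v2 P1 = v2 P2"
  using assms
proof (induction s arbitrary: i ds u r v)
  case Nil
  have u: "u < pi / 2"
    using turns_edges_sum_pos[OF Nil.prems(1)] Nil.prems(2) by simp
  then have cu: "cos u > 0" using Nil.prems(3) cos_gt_zero_pi by blast
  have d: "distinct [i, P3, third i P3]"
    using Nil.prems(9) by (intro distinct_third) auto
  define e where "e = coll_angle m (third i P3)"
  obtain d0 where "ds = [d0]" "turn \<kappa> d0 e"
    using Nil.prems(1) by (auto simp: list_all2_Cons2 e_def)
  then have k: "\<kappa> * cos u = sin e"
    using Nil.prems(2) by (simp add: turn_def sin_diff)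
  have nr: "rel_norm2 m r \<noteq> 0"
    using Nil.prems(8) zero_le_power2[of "tan u"] by linarith
  obtain w where w: "meet_at P3 w" "rel_form m r w = rel_form m r v"
    using meet_target[of i P3 r "rel_form m r v"] d Nil.prems(4) nr by auto
  have "(cos e)\<^sup>2 * ((1 + (tan u)\<^sup>2) * rel_norm2 m w) = (tan u)\<^sup>2 + (1 - \<kappa>\<^sup>2)"
    using rel_form_meet_cos[OF d Nil.prems(4) w(1)] Nil.prems(10)
    unfolding w(2) Nil.prems(7,8) by (simp add: cmod_power2 e_def)
  then have "rel_norm2 m w = 1"
    using norm2_from_infinity cu k cos_coll_angle_pos e_def by metis
  then obtain x v' c where v': "scatter m i x v v'" "\<And>p. v' p = w p + c"
    using scatter_to[of i r v w] Nil.prems nr w by metis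
  have "v' P1 = v' P2"
    using w(1) v'(2) meet_at_iff[of P3 P1 P2 w] by simp
  then show ?case
    using v'(1) no_collision by blast
next
  case (Cons j s)
  define e where "e = coll_angle m (third i j)"
  obtain d0 ds' where ds: "ds = d0 # ds'" "turn \<kappa> d0 e" "list_all2 (turn \<kappa>) ds' (edge_angles m j s)"
    using Cons.prems(1) by (auto simp: list_all2_Cons2 e_def)
  define u' where "u' = u + d0"
  have uu: "u < u'" using ds(2) by (simp add: u'_def turn_def)
  have u': "u' < pi / 2"
    using turns_edges_sum_pos[OF ds(3)] Cons.prems(2) ds(1) by (simp add: u'_def)
  have sum': "sum_list ds' = pi / 2 - u'"
    using Cons.prems(2) ds(1) by (simp add: u'_def)
  have c: "cos u > 0" "cos u' > 0"
    using Cons.prems(3) uu u' by (auto intro!: cos_gt_zero_pi)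
  have k: "\<kappa> * sin (u' - u) = sin e" using ds(2) by (simp add: turn_def u'_def)
  \<comment> \<open>At speed 1 the real part of the product grows by the elapsed time, so this is
    the duration of the leg.\<close>
  define t where "t = tan u' - tan u"
  have t: "t > 0" using tan_monotone[of u u'] Cons.prems(3) uu u' by (simp add: t_def)
  have ne: "i \<noteq> j" using Cons.prems(9) by simp
  have d: "distinct [i, j, third i j]" using ne by (rule distinct_third)
  have nr: "rel_norm2 m r \<noteq> 0"
    using Cons.prems(8) zero_le_power2[of "tan u"] by linarith
  \<comment> \<open>The product of \<open>r\<close> with \<open>r + t w\<close> for any
    \<open>w\<close> that has the same product with \<open>r\<close> as \<open>v\<close>.\<close>
  define Z where "Z = of_real (rel_norm2 m r) + of_real t * rel_form m r v"
  obtain r' where r': "meet_at j r'" "rel_form m r r' = Z"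
    using meet_target[OF ne Cons.prems(4) nr] by metis
  have Z: "Re Z = 1 + tan u * tan u'" "Im Z = (tan u' - tan u) * J"
    unfolding Z_def Cons.prems(7,8) by (simp_all add: t_def power2_eq_square algebra_simps)
  have "(cos e)\<^sup>2 * ((1 + (tan u)\<^sup>2) * rel_norm2 m r') =
      (1 + tan u * tan u')\<^sup>2 + (tan u' - tan u)\<^sup>2 * (1 - \<kappa>\<^sup>2)"
    using rel_form_meet_cos[OF d Cons.prems(4) r'(1)] Cons.prems(10)
    unfolding r'(2) Cons.prems(8) by (simp add: cmod_power2 Z power_mult_distrib e_def)
  then have nr': "rel_norm2 m r' = 1 + (tan u')\<^sup>2"
    using norm2_from_turn[of u u' e \<kappa>] c k cos_coll_angle_pos e_def by metis
  define w where "w = (\<lambda>p. (r' p - r p) / of_real t)"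
  have r'w: "r' = (\<lambda>p. r p + of_real t * w p)"
    using t by (simp add: w_def)
  have "of_real (rel_norm2 m r) + of_real t * rel_form m r w = Z"
    using r'(2) unfolding r'w rel_form_add_right rel_form_self .
  then have fw: "rel_form m r w = rel_form m r v"
    using t by (simp add: Z_def)
  \<comment> \<open>Comparing the norm found for \<open>r'\<close> with its expansion along the leg
    forces speed 1.\<close>
  have "1 + (tan u')\<^sup>2 = 1 + (tan u)\<^sup>2 + 2 * t * tan u + t\<^sup>2 * rel_norm2 m w"
    using nr' unfolding r'w rel_norm2_add fw Cons.prems(7,8) by simp
  then have "t\<^sup>2 * rel_norm2 m w = t\<^sup>2"
    by (simp add: t_def power2_eq_square algebra_simps)
  then have "rel_norm2 m w = rel_norm2 m v"
    using t Cons.prems(6) by simp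
  then obtain x v1 c where v1: "scatter m i x v v1" "\<And>p. v1 p = w p + c"
    using scatter_to[of i r v w] Cons.prems nr fw by metis
  define r1 where "r1 = (\<lambda>p. r p + complex_of_real t * v1 p)"
  have r1: "r1 p = r' p + of_real t * c" for p
    by (simp add: r1_def r'w v1(2) algebra_simps)
  have m1: "meet_at j r1"
    using r'(1) meet_at_translate[of r1 r' "of_real t * c" j, OF r1] by simp
  have nv1: "rel_norm2 m v1 = 1" using rel_norm2_scatter[OF v1(1)] Cons.prems(6) by simp
  have "rel_form m r v1 = rel_form m r v"
    using rel_form_scatter[OF Cons.prems(4) v1(1)] .
  then have f1: "rel_form m r1 v1 = Complex (tan u') J"
    unfolding r1_def rel_form_add_left rel_form_self nv1 Cons.prems(7)
    by (simp add: complex_eq_iff t_def)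
  have n1: "rel_norm2 m r1 = 1 + (tan u')\<^sup>2"
    using rel_norm2_translate[of r1 r' "of_real t * c" m, OF r1] nr' by simp
  \<comment> \<open>Otherwise the whole leg would stay on L_j, and \<open>r\<close> would lie on two
    collision lines, hence have norm 0.\<close>
  have "\<not> meet_at j v1"
  proof
    assume "meet_at j v1"
    then have "meet_at j r"
      using m1 t unfolding r1_def meet_at_def by (metis add_right_cancel)
    then show False using meet_two_norm2[OF ne Cons.prems(4)] nr by blast
  qed
  then obtain x' v1' r2 v2 where "scatter m j x' v1 v1'" "evolves m r1 v1' s r2 v2" "v2 P1 = v2 P2"
    using Cons.IH[OF ds(3) sum' _ m1 _ nv1 f1 n1] Cons.prems(3,9,10) uu by auto
  then show ?case
    using v1(1) collision[OF t r1_def m1] by blast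
qed

text \<open>A unit velocity is placed on L_1, then \<open>r\<close> on the line of the first
  collision with the product that the first turn prescribes; \<open>turns_evolves\<close> continues
  from there.\<close>

lemma turns_capture_process:
  assumes "0 < \<kappa>" "\<kappa> \<le> 1" "list_all2 (turn \<kappa>) ds (edge_angles m P1 s)" "sum_list ds = pi"
    and "distinct_adj (P1 # s @ [P3])" "s \<noteq> []"
  shows "capture_process m s"
proof -
  obtain i s' where s: "s = i # s'" using assms(6) by (cases s) auto
  define e where "e = coll_angle m (third P1 i)"
  obtain d0 ds' where ds: "ds = d0 # ds'" "turn \<kappa> d0 e" "list_all2 (turn \<kappa>) ds' (edge_angles m i s')"
    using assms(3) by (auto simp: list_all2_Cons2 e_def s)
  define u where "u = d0 - pi / 2"
  have u0: "- (pi / 2) < u" using ds(2) by (simp add: u_def turn_def)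
  have u1: "u < pi / 2" using turns_edges_sum_pos[OF ds(3)] assms(4) ds(1) by (simp add: u_def)
  have sum': "sum_list ds' = pi / 2 - u" using assms(4) ds(1) by (simp add: u_def)
  have cu: "cos u > 0" using u0 u1 by (rule cos_gt_zero_pi)
  have k: "\<kappa> * cos u = sin e" using ds(2) by (simp add: u_def turn_def cos_diff)
  have ne: "P1 \<noteq> i" using assms(5) s by simp
  have d: "distinct [P1, i, third P1 i]" using ne by (rule distinct_third)
  define J where "J = sqrt (1 - \<kappa>\<^sup>2)"
  have "\<kappa>\<^sup>2 \<le> 1" using assms(1,2) by (simp add: power_le_one)
  then have J: "J\<^sup>2 = 1 - \<kappa>\<^sup>2" by (simp add: J_def)
  define n where "n = m P1 * (m P2 + m P3)"
  have n: "n > 0" using pos[of P1] pos[of P2] pos[of P3] by (simp add: n_def)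
  define v where "v = (\<lambda>p. if p = P1 then complex_of_real (1 / sqrt n) else 0)"
  have mv: "meet_at P1 v" using meet_at_iff[of P1 P2 P3 v] by (simp add: v_def)
  have nv: "rel_norm2 m v = 1"
    using rel_norm2_meet[of P1 P2 P3 v] mv n
    by (simp add: v_def n_def[symmetric] norm_divide power_divide)
  obtain r where r: "meet_at i r" "rel_form m v r = cnj (Complex (tan u) J)"
    using meet_target[OF ne mv] nv by (metis zero_neq_one)
  have f: "rel_form m r v = Complex (tan u) J"
    using r(2) by (metis cnj_rel_form complex_cnj_cnj)
  have nr: "rel_norm2 m r = 1 + (tan u)\<^sup>2"
  proof -
    have c: "(cos e)\<^sup>2 * rel_norm2 m r = (tan u)\<^sup>2 + (1 - \<kappa>\<^sup>2)"
      using rel_form_meet_cos[OF d mv r(1)] J unfolding r(2) nv by (simp add: cmod_power2 e_def)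
    have t: "1 + (tan u)\<^sup>2 \<noteq> 0" using zero_le_power2[of "tan u"] by linarith
    have "rel_norm2 m r / (1 + (tan u)\<^sup>2) = 1"
      by (rule norm2_from_infinity[OF cu _ k]) (use c t cos_coll_angle_pos in \<open>auto simp: e_def\<close>)
    then show ?thesis using t by simp
  qed
  have nr0: "rel_norm2 m r \<noteq> 0"
    using nr zero_le_power2[of "tan u"] by linarith
  have r23: "r P2 \<noteq> r P3"
    using meet_two_norm2[OF ne _ r(1)] nr0 meet_at_iff[of P1 P2 P3 r] by auto
  have "\<not> meet_at i v"
    using meet_two_norm2[OF ne mv] nv by auto
  then obtain x v1 r2 v2 where ev: "scatter m i x v v1" "evolves m r v1 s' r2 v2" "v2 P1 = v2 P2"
    using turns_evolves[OF ds(3) sum' u0 r(1) _ nv f nr _ J] assms(5) s by auto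
  \<comment> \<open>The motion starts one unit of time before the first collision.\<close>
  define r0 where "r0 = (\<lambda>p. r p - v p)"
  have r0: "r = (\<lambda>p. r0 p + complex_of_real 1 * v p)" by (simp add: r0_def)
  have "evolves m r0 v s r2 v2"
    unfolding s using collision[OF zero_less_one r0 r(1) ev(1,2)] .
  moreover have "v P2 = 0" "v P3 = 0" "v P1 \<noteq> 0" "r0 P2 \<noteq> r0 P3"
    using n r23 by (simp_all add: v_def r0_def)
  ultimately show ?thesis
    using ev(3) unfolding capture_process_def by blast
qed

lemma capture_process_iff_turns:
  assumes "distinct_adj (P1 # s @ [P3])" "s \<noteq> []"
  shows "capture_process m s \<longleftrightarrow> (\<exists>\<kappa>. 0 < \<kappa> \<and> \<kappa> \<le> 1 \<and>
     (\<exists>ds. list_all2 (turn \<kappa>) ds (edge_angles m P1 s) \<and> sum_list ds = pi))"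
  using capture_process_turns turns_capture_process assms by blast

end

subsection \<open>Turning angles with total pi\<close>

text \<open>Induction on sin ((m + 1) x) / sin x = cos x * sin (m x) / sin x + cos (m x): every
  ingredient is nonincreasing in x, and the factors of the product are nonnegative.\<close>

lemma sin_multiple_ratio:
  fixes x y :: real
  assumes "0 < x" "x \<le> y" "real m * y \<le> pi"
  shows "sin (real m * y) * sin x \<le> sin (real m * x) * sin y"
  using assms(3)
proof (induction m)
  case 0
  then show ?case by simp
next
  case (Suc m)
  show ?case
  proof (cases "m = 0")
    case True
    then show ?thesis by simp
  next
    case False
    then have "2 * y \<le> real (Suc m) * y"
      using assms(1,2) by (intro mult_right_mono) auto
    then have y2: "y \<le> pi / 2" using Suc.prems by linarith
    have my: "real m * y \<le> pi" using Suc.prems assms(1,2) by (simp add: algebra_simps)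
    have xy: "real m * x \<le> real m * y" using assms(2) by (simp add: mult_left_mono)
    have IH: "sin (real m * y) * sin x \<le> sin (real m * x) * sin y" using Suc.IH my by simp
    have cy: "0 \<le> cos y" using y2 assms(1,2) by (intro cos_ge_zero) auto
    have cyx: "cos y \<le> cos x" using assms(1,2) y2 pi_gt_zero by (intro cos_monotone_0_pi_le) linarith+
    have cm: "cos (real m * y) \<le> cos (real m * x)"
      using xy my assms(1) by (intro cos_monotone_0_pi_le) auto
    have sx: "0 \<le> sin x" "0 \<le> sin y"
      using assms(1,2) y2 pi_gt_zero by (auto intro!: sin_ge_zero)
    have sm: "0 \<le> sin (real m * x)" using xy my assms(1) by (intro sin_ge_zero) auto
    have "sin (real (Suc m) * y) * sin x = (sin (real m * y) * sin x) * cos y + cos (real m * y) * (sin y * sin x)"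
      by (simp add: algebra_simps sin_add)
    also have "\<dots> \<le> (sin (real m * x) * sin y) * cos y + cos (real m * x) * (sin y * sin x)"
      using IH cy cm sx by (intro add_mono mult_right_mono) auto
    also have "\<dots> \<le> (sin (real m * x) * sin y) * cos x + cos (real m * x) * (sin y * sin x)"
      using cyx sm sx by (intro add_right_mono mult_left_mono) auto
    also have "\<dots> = sin (real (Suc m) * x) * sin y"
      by (simp add: algebra_simps sin_add)
    finally show ?thesis .
  qed
qed

text \<open>The other solution \<open>y = pi - x\<close> is excluded by the sum.\<close>

lemma sin_eq_sum_less_pi:
  fixes x y :: real
  assumes "0 < x" "0 < y" "x + y < pi" "sin x = sin y"
  shows "x = y"
proof (rule ccontr)
  assume "x \<noteq> y"
  have "0 = 2 * sin ((x - y) / 2) * cos ((x + y) / 2)"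
    using assms(4) sin_diff_sin[of x y] by simp
  moreover have "cos ((x + y) / 2) > 0"
    using assms by (intro cos_gt_zero_pi) auto
  ultimately have "sin ((x - y) / 2) = 0" by simp
  moreover have "- pi < (x - y) / 2" "(x - y) / 2 < pi" using assms by (simp_all add: field_simps)
  ultimately have "(x - y) / 2 = 0" using sin_eq_0_pi by blast
  then show False using \<open>x \<noteq> y\<close> by simp
qed

lemma sum_list_two_le:
  fixes ds :: "real list"
  assumes "\<forall>x\<in>set ds. 0 < x" "p < length ds" "q < length ds" "p \<noteq> q"
  shows "ds ! p + ds ! q \<le> sum_list ds"
proof -
  have "(\<Sum>k\<in>{p, q}. ds ! k) \<le> (\<Sum>k\<in>{0..<length ds}. ds ! k)"
    using assms by (intro sum_mono2) (auto intro!: less_imp_le)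
  then show ?thesis
    using assms by (simp add: sum_list_sum_nth)
qed

text \<open>
  Two turns through the same angle \<open>\<phi>\<close> with total below \<open>pi\<close> are equal, so all
  of them equal some \<open>\<beta>\<close>, and the criterion says that \<open>sin (m \<beta>) / sin \<beta> = sin \<eta> / sin \<phi>\<close>
  has a solution in \<open>[\<phi>, pi / m)\<close>, on which the left-hand side decreases.
\<close>

lemma turns_exist_iff:
  fixes \<phi> \<eta> :: real
  assumes \<phi>: "0 < \<phi>" "\<phi> < pi / 2" and \<eta>: "0 < \<eta>" "\<eta> < pi / 2" and m: "m \<ge> 2"
  shows "(\<exists>\<kappa>. 0 < \<kappa> \<and> \<kappa> \<le> 1 \<and> (\<exists>d ds. turn \<kappa> d \<eta> \<and> length ds = m \<and>
            (\<forall>x\<in>set ds. turn \<kappa> x \<phi>) \<and> d + sum_list ds = pi)) \<longleftrightarrow>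
         real m * \<phi> < pi \<and> sin \<eta> \<le> sin (real m * \<phi>)" (is "?L \<longleftrightarrow> ?R")
proof
  assume ?L
  then obtain \<kappa> d ds where \<kappa>: "0 < \<kappa>" "\<kappa> \<le> 1" and d: "turn \<kappa> d \<eta>" and l: "length ds = m"
    and t: "\<forall>x\<in>set ds. turn \<kappa> x \<phi>" and s: "d + sum_list ds = pi"
    by blast
  have d0: "0 < d" "\<kappa> * sin d = sin \<eta>" using d by (auto simp: turn_def)
  have p: "\<forall>x\<in>set ds. 0 < x" using t by (auto simp: turn_def)
  define \<beta> where "\<beta> = ds ! 0"
  have eqb: "ds ! q = \<beta>" if "q < length ds" for q
  proof (cases "q = 0")
    case False
    have "ds ! 0 \<in> set ds" "ds ! q \<in> set ds" using that by (auto intro!: nth_mem)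
    then have "turn \<kappa> (ds ! 0) \<phi>" "turn \<kappa> (ds ! q) \<phi>" using t by auto
    then have "\<kappa> * sin (ds ! q) = \<kappa> * sin (ds ! 0)" "0 < ds ! 0" "0 < ds ! q"
      by (auto simp: turn_def)
    then have "sin (ds ! q) = sin (ds ! 0)" "0 < ds ! 0" "0 < ds ! q"
      using \<kappa>(1) by auto
    \<comment> \<open>The turn \<open>d\<close> is positive, so two of the others stay strictly
      below the total pi.\<close>
    moreover have "ds ! q + ds ! 0 < pi"
      using sum_list_two_le[OF p that, of 0] False that l m s d0 by auto
    ultimately show ?thesis
      unfolding \<beta>_def using sin_eq_sum_less_pi by blast
  qed (simp add: \<beta>_def)
  have "ds = replicate m \<beta>"
    using l eqb by (intro nth_equalityI) auto
  then have sum: "sum_list ds = real m * \<beta>" by (simp add: sum_list_replicate)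
  have "\<beta> \<in> set ds" using l m by (simp add: \<beta>_def)
  then have b: "0 < \<beta>" "\<kappa> * sin \<beta> = sin \<phi>" using t by (auto simp: turn_def)
  have mb: "real m * \<beta> < pi" using s sum d0 by simp
  have "2 * \<beta> \<le> real m * \<beta>" using m b(1) by (intro mult_right_mono) auto
  then have b2: "\<beta> < pi / 2" using mb by simp
  have sb: "sin \<beta> > 0" using b b2 by (intro sin_gt_zero) auto
  \<comment> \<open>\<open>\<kappa> \<le> 1\<close> puts \<beta> to the right of \<phi>, where the
    ratio has decreased.\<close>
  have "sin \<phi> \<le> sin \<beta>" using b(2) sb \<kappa> by (metis less_eq_real_def mult_left_le_one_le)
  then have le: "\<phi> \<le> \<beta>" using \<phi> b b2 by (subst (asm) sin_mono_le_eq) auto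
  have "d = pi - real m * \<beta>" using s sum by simp
  then have "sin d = sin (real m * \<beta>)" by simp
  then have "sin \<eta> * sin \<beta> = sin (real m * \<beta>) * sin \<phi>"
    using d0(2) b(2) by (metis mult.commute mult.left_commute)
  also have "\<dots> \<le> sin (real m * \<phi>) * sin \<beta>"
    using mb by (intro sin_multiple_ratio \<phi> le) auto
  finally have "sin \<eta> \<le> sin (real m * \<phi>)" using sb by simp
  moreover have "real m * \<phi> \<le> real m * \<beta>" using le by (simp add: mult_left_mono)
  ultimately show ?R using mb by linarith
next
  assume R: ?R
  have s\<phi>: "sin \<phi> > 0" using \<phi> by (intro sin_gt_zero) auto
  have s\<eta>: "sin \<eta> > 0" using \<eta> by (intro sin_gt_zero) auto
  \<comment> \<open>At a zero \<beta>, the value \<open>sin \<phi> / sin \<beta>\<close> serves as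
    \<kappa> both for \<beta> and for \<open>pi - real m * \<beta>\<close>.\<close>
  define f where "f = (\<lambda>x. sin (real m * x) * sin \<phi> - sin \<eta> * sin x)"
  have m0: "real m > 0" using m by simp
  have le: "\<phi> \<le> pi / real m" using R m0 by (simp add: pos_le_divide_eq mult.commute)
  have pm: "0 < pi / real m" "pi / real m \<le> pi / 2"
    using m divide_left_mono[of 2 "real m" pi] by auto
  have "f (pi / real m) \<le> 0"
    using m0 pm s\<eta> by (simp add: f_def)
  moreover have "0 \<le> f \<phi>"
    using R s\<phi> by (simp add: f_def)
  moreover have "continuous_on {\<phi>..pi / real m} f"
    unfolding f_def by (intro continuous_intros)
  ultimately obtain \<beta> where b: "\<phi> \<le> \<beta>" "\<beta> \<le> pi / real m" "f \<beta> = 0"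
    using IVT2'[of f "pi / real m" 0 \<phi>] le by auto
  have sb: "sin \<beta> > 0" using b pm \<phi> pi_gt_zero by (intro sin_gt_zero) linarith+
  have eq: "sin (real m * \<beta>) * sin \<phi> = sin \<eta> * sin \<beta>" using b(3) by (simp add: f_def)
  \<comment> \<open>The right end would leave no positive angle for the turn through \<eta>.\<close>
  have "\<beta> \<noteq> pi / real m"
  proof
    assume "\<beta> = pi / real m"
    then have "sin (real m * \<beta>) = 0" using m0 by simp
    then show False using eq sb s\<eta> by simp
  qed
  then have mb: "real m * \<beta> < pi" using b(2) m0 by (simp add: field_simps)
  define \<kappa> where "\<kappa> = sin \<phi> / sin \<beta>"
  have "sin \<phi> \<le> sin \<beta>" using b(1,2) pm \<phi> by (intro sin_monotone_2pi_le) linarith+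
  then have k: "0 < \<kappa>" "\<kappa> \<le> 1" using s\<phi> sb by (auto simp: \<kappa>_def)
  have "turn \<kappa> (pi - real m * \<beta>) \<eta>"
    using mb eq sb by (simp add: turn_def \<kappa>_def field_simps)
  moreover have "turn \<kappa> \<beta> \<phi>"
    using sb b(1) \<phi>(1) by (simp add: turn_def \<kappa>_def)
  ultimately show ?L
    using k by (intro exI[of _ \<kappa>] conjI exI[of _ "pi - real m * \<beta>"] exI[of _ "replicate m \<beta>"])
      (auto simp: sum_list_replicate)
qed

subsection \<open>Boundary curves and admissible lengths\<close>

lemma cot_npi_minus: "cot (real k * pi - x) = - cot (x :: real)"
  by (cases "even k") (simp_all add: cot_def cos_diff sin_diff)

lemma cot_half_pi: "cot (pi / 2 - x) = tan (x :: real)" "cot (pi / 2 + x) = - tan (x :: real)"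
  by (simp_all add: cot_def tan_def cos_diff sin_diff cos_add sin_add)

text \<open>Substitute \<theta> = pi - 2 A. With B = pi - A - C the point is (tan A / tan B, tan C /
  tan B), that is (a, b). The lower bound on \<theta> expresses C < pi / 2 and the upper one A + C >
  pi / 2.\<close>

lemma odd_curve_memI:
  fixes A C :: real
  assumes "C < pi / 2" "pi / 2 < A + C" "k \<ge> 1" "C = (2 * real k - 1) * A"
  shows "(tan A * cot (pi - A - C), tan C * cot (pi - A - C)) \<in> odd_curve k"
proof -
  define \<theta> where "\<theta> = pi - 2 * A"
  have k: "real k \<ge> 1" using assms(3) by simp
  have c: "cot (pi - A - C) = - cot (A + C)"
    using cot_npi_minus[of 1 "A + C"] by (simp add: algebra_simps)
  have "cot (\<theta> / 2) = tan A"
    using cot_half_pi(1)[of A] by (simp add: \<theta>_def diff_divide_distrib)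
  moreover have "real k * \<theta> = real k * pi - (A + C)"
    by (simp add: \<theta>_def assms(4) algebra_simps)
  then have "cot (real k * \<theta>) = - cot (A + C)"
    by (simp add: cot_npi_minus)
  moreover have "(real k - 1 / 2) * \<theta> = real k * pi - (pi / 2 + C)"
    by (simp add: \<theta>_def assms(4) algebra_simps)
  then have "cot ((real k - 1 / 2) * \<theta>) = tan C"
    by (simp add: cot_npi_minus cot_half_pi)
  moreover have "(2 * real k - 2) * pi < \<theta> * (2 * real k - 1)"
    using assms(1,4) by (simp add: \<theta>_def algebra_simps)
  then have "(2 * real k - 2) * pi / (2 * real k - 1) < \<theta>"
    using k by (intro pos_divide_less_eq[THEN iffD2]) auto
  moreover have "\<theta> * (2 * real k) < (2 * real k - 1) * pi"
    using assms(2,4) by (simp add: \<theta>_def algebra_simps)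
  then have "\<theta> < (2 * real k - 1) * pi / (2 * real k)"
    using k by (intro pos_less_divide_eq[THEN iffD2]) auto
  ultimately show ?thesis
    unfolding odd_curve_def c by (intro CollectI exI[of _ \<theta>]) (simp add: mult.commute)
qed

text \<open>The same substitution; now 2 k A = B, and the two bounds on \<theta> exchange their
  meaning.\<close>

lemma even_curve_memI:
  fixes A C :: real
  assumes "C < pi / 2" "pi / 2 < A + C" "k \<ge> 1" "pi - C = (2 * real k + 1) * A"
  shows "(tan A * cot (pi - A - C), tan C * cot (pi - A - C)) \<in> even_curve k"
proof -
  define \<theta> where "\<theta> = pi - 2 * A"
  have k: "real k \<ge> 1" using assms(3) by simp
  have "cot (\<theta> / 2) = tan A"
    using cot_half_pi(1)[of A] by (simp add: \<theta>_def diff_divide_distrib)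
  moreover have "real k * \<theta> = real k * pi - (pi - A - C)"
    using assms(4) by (simp add: \<theta>_def algebra_simps)
  then have "cot (real k * \<theta>) = - cot (pi - A - C)"
    by (simp only: cot_npi_minus)
  moreover have "(real k + 1 / 2) * \<theta> = real k * pi - (pi / 2 - C)"
    using assms(4) by (simp add: \<theta>_def algebra_simps)
  then have "cot ((real k + 1 / 2) * \<theta>) = - tan C"
    by (simp only: cot_npi_minus cot_half_pi)
  moreover have "(2 * real k - 1) * pi < \<theta> * (2 * real k)"
    using assms(2,4) by (simp add: \<theta>_def algebra_simps)
  then have "(2 * real k - 1) * pi / (2 * real k) < \<theta>"
    using k by (intro pos_divide_less_eq[THEN iffD2]) auto
  moreover have "\<theta> * (2 * real k + 1) < 2 * real k * pi"
    using assms(1,4) by (simp add: \<theta>_def algebra_simps)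
  then have "\<theta> < 2 * real k * pi / (2 * real k + 1)"
    using k by (intro pos_less_divide_eq[THEN iffD2]) auto
  ultimately show ?thesis
    unfolding even_curve_def by (intro CollectI exI[of _ \<theta>]) (simp add: mult.commute)
qed

section \<open>Admissible numbers of equal turns\<close>

lemma sin_le_sin_iff:
  fixes x e :: real
  assumes "0 < e" "e \<le> pi / 2" "0 < x"
  shows "x < pi \<and> sin e \<le> sin x \<longleftrightarrow> e \<le> x \<and> x \<le> pi - e"
proof (cases "x \<le> pi / 2")
  case True
  then have "sin e \<le> sin x \<longleftrightarrow> e \<le> x"
    using assms by (intro sin_mono_le_eq) auto
  then show ?thesis using True assms pi_gt_zero by linarith
next
  case False
  have "x < pi \<Longrightarrow> sin e \<le> sin (pi - x) \<longleftrightarrow> e \<le> pi - x"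
    using False assms by (intro sin_mono_le_eq) auto
  then show ?thesis using False assms by auto
qed

text \<open>The condition \<eta> \<le> k A \<le> pi - \<eta> with \<eta> = B for even k and \<eta> =
  C for odd k, after eliminating B by A + B + C = pi. In this form both cases compare odd multiples
  of A with C and pi - C.\<close>

definition admissible :: "nat \<Rightarrow> real \<Rightarrow> real \<Rightarrow> bool" where
  "admissible k A C \<longleftrightarrow>
     (if even k then (real k - 1) * A \<le> C \<and> pi - C \<le> (real k + 1) * A
      else C \<le> real k * A \<and> real k * A \<le> pi - C)"

lemma admissible_iff_sin:
  fixes A B C :: real
  assumes "0 < A" "0 < B" "B < pi / 2" "0 < C" "C < pi / 2" "A + B + C = pi" "k \<ge> 1"
  shows "real k * A < pi \<and> sin (if even k then B else C) \<le> sin (real k * A) \<longleftrightarrow> admissible k A C"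
proof -
  have "0 < real k * A" using assms by simp
  then have "real k * A < pi \<and> sin (if even k then B else C) \<le> sin (real k * A) \<longleftrightarrow>
      (if even k then B else C) \<le> real k * A \<and> real k * A \<le> pi - (if even k then B else C)"
    using assms by (intro sin_le_sin_iff) auto
  also have "\<dots> \<longleftrightarrow> admissible k A C"
    using assms(6) by (auto simp: admissible_def algebra_simps)
  finally show ?thesis .
qed

text \<open>Take the first odd multiple of A above C. If it is at most pi - C, its index is the odd
  \<open>k\<close>; otherwise it jumps beyond pi - C from a predecessor at most C, and the even
  number between the two indices works.\<close>

lemma admissible_exists:
  assumes "0 < A" "A \<le> C"
  shows "\<exists>k\<ge>2. admissible k A C"
proof -
  define P where "P = (\<lambda>n. C < real (2 * n + 1) * A)"
  obtain N where "C / A < real N" using reals_Archimedean2 by blast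
  then have "C < real N * A" using assms by (simp add: pos_divide_less_eq)
  also have "\<dots> \<le> real (2 * N + 1) * A" using assms by (intro mult_right_mono) auto
  finally have "P N" by (simp add: P_def)
  define n where "n = (LEAST n. P n)"
  have n: "P n" unfolding n_def using \<open>P N\<close> by (rule LeastI)
  \<comment> \<open>\<open>A \<le> C\<close> excludes n = 0, which keeps \<open>k\<close> at least
    2.\<close>
  have "\<not> P 0" using assms by (simp add: P_def)
  then obtain l where l: "n = Suc l" using n by (cases n) auto
  then have nl: "\<not> P l" using not_less_Least[of l P] by (simp add: n_def)
  show ?thesis
  proof (cases "real (2 * n + 1) * A \<le> pi - C")
    case True
    then show ?thesis
      using n l by (intro exI[of _ "2 * n + 1"]) (auto simp: admissible_def P_def algebra_simps)
  next
    case False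
    then show ?thesis
      using nl l by (intro exI[of _ "2 * n"]) (auto simp: admissible_def P_def algebra_simps)
  qed
qed

text \<open>For even \<open>k\<close> already (k - 1) C exceeds A; for odd \<open>k\<close> at least
  3, 3 C + A = 2 C + (A + C) exceeds pi.\<close>

lemma not_admissible_swap:
  assumes "0 < A" "A < C" "pi / 2 < A + C" "k \<ge> 2"
  shows "\<not> admissible k C A"
proof (cases "even k")
  case True
  have "1 * C \<le> (real k - 1) * C" using assms by (intro mult_right_mono) auto
  moreover have "(real k - 1) * C \<le> A" if "admissible k C A"
    using True that by (simp add: admissible_def)
  ultimately show ?thesis using assms(2) by fastforce
next
  case False
  then have "k \<ge> 3" using assms(4) by presburger
  then have "3 * C \<le> real k * C" using assms by (intro mult_right_mono) auto
  moreover have "real k * C \<le> pi - A" if "admissible k C A"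
    using False that by (simp add: admissible_def)
  ultimately show ?thesis using assms(2,3) by fastforce
qed

text \<open>Odd multiples for two odd indices differ by at least 2 A, more than the width pi - 2 C
  of the window; two even indices would give pi - C \<le> C. Different parities squeeze an odd
  multiple of A onto an end of the window, which the last two hypotheses exclude.\<close>

lemma admissible_unique_less:
  assumes A: "0 < A" and C: "C < pi / 2" "pi / 2 < A + C" and k: "2 \<le> k" "k < l"
    and adm: "admissible k A C" "admissible l A C"
    and odd: "\<And>j. odd j \<Longrightarrow> real j * A \<noteq> C" and even: "\<And>j. even j \<Longrightarrow> j \<ge> 2 \<Longrightarrow> (real j + 1) * A \<noteq> pi - C"
  shows False
proof -
  have mono: "x \<le> y \<Longrightarrow> x * A \<le> y * A" for x y :: real
    using A by (simp add: mult_right_mono)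
  consider "odd k" "odd l" | "odd k" "even l" | "even k" "odd l" | "even k" "even l" by blast
  then show False
  proof cases
    case 1
    then have "k + 2 \<le> l" using k by presburger
    then have "real k * A + 2 * A \<le> real l * A"
      using mono[of "real k + 2" "real l"] by (simp add: algebra_simps)
    then show False using 1 adm C by (auto simp: admissible_def)
  next
    case 2
    have "real k * A \<le> (real l - 1) * A" using k by (intro mono) auto
    then show False using 2 adm odd[of k] by (auto simp: admissible_def)
  next
    case 3
    have "(real k + 1) * A \<le> real l * A" using k by (intro mono) auto
    then show False using 3 adm even[of k] k by (auto simp: admissible_def)
  next
    case 4
    then have "k + 2 \<le> l" using k by presburger
    then have "(real k + 1) * A \<le> (real l - 1) * A" by (intro mono) auto
    moreover have "pi - C \<le> (real k + 1) * A" "(real l - 1) * A \<le> C"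
      using 4 adm by (simp_all add: admissible_def)
    ultimately show False using C by linarith
  qed
qed

lemma admissible_unique:
  assumes "0 < A" "C < pi / 2" "pi / 2 < A + C" "2 \<le> k" "2 \<le> l"
    and "admissible k A C" "admissible l A C"
    and "\<And>j. odd j \<Longrightarrow> real j * A \<noteq> C" "\<And>j. even j \<Longrightarrow> j \<ge> 2 \<Longrightarrow> (real j + 1) * A \<noteq> pi - C"
  shows "k = l"
  using admissible_unique_less[of A C k l] admissible_unique_less[of A C l k] assms
  by (metis linorder_neqE_nat)

subsection \<open>Allowed regions\<close>

lemma rep_simps [simp]: "rep 0 s = []" "rep (Suc n) s = s @ rep n s"
  by (simp_all add: rep_def)

text \<open>\<open>k\<close> counts the collisions and also the equal turns; 2 n and 2 n + 1 give
  the two strings belonging to one n. The suffix is the label of the repeated angle.\<close>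

definition run_1 :: "nat \<Rightarrow> particle list" where
  "run_1 k = (if even k then rep (k div 2) [P3, P2] else [P2] @ rep (k div 2) [P3, P2])"

definition run_3 :: "nat \<Rightarrow> particle list" where
  "run_3 k = (if even k then rep (k div 2) [P2, P1] else rep (k div 2) [P2, P1] @ [P2])"

text \<open>The extra 1 is the edge from L_2 to L_3 that closes the chain.\<close>

lemma edge_angles_rep_32: "edge_angles m P2 (rep n [P3, P2]) = replicate (2 * n + 1) (coll_angle m P1)"
  by (induction n) auto

lemma edge_angles_rep_21:
  "edge_angles m P1 (rep n [P2, P1] @ s) = replicate (2 * n) (coll_angle m P3) @ edge_angles m P1 s"
  by (induction n) auto

lemma edge_angles_run_1:
  assumes "k \<ge> 2"
  shows "edge_angles m P1 (run_1 k) =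
     coll_angle m (if even k then P2 else P3) # replicate k (coll_angle m P1)"
proof (cases "even k")
  case True
  then obtain n where "k = 2 * Suc n"
    using assms by (metis evenE mult_0_right not0_implies_Suc not_numeral_le_zero)
  then show ?thesis by (simp add: run_1_def edge_angles_rep_32)
next
  case False
  then obtain n where "k = 2 * n + 1" by (rule oddE)
  then show ?thesis by (simp add: run_1_def edge_angles_rep_32)
qed

lemma edge_angles_run_3:
  "edge_angles m P1 (run_3 k) =
     replicate k (coll_angle m P3) @ [coll_angle m (if even k then P2 else P1)]"
proof (cases "even k")
  case True
  then show ?thesis using edge_angles_rep_21[of m "k div 2" "[]"] by (auto simp: run_3_def)
next
  case False
  then obtain n where "k = 2 * n + 1" by (rule oddE)
  then show ?thesis by (simp add: run_3_def edge_angles_rep_21 replicate_append_same)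
qed

lemma distinct_adj_rep_32: "distinct_adj (P2 # rep n [P3, P2] @ [P3])"
  by (induction n) auto

lemma distinct_adj_rep_21: "hd s \<noteq> P1 \<Longrightarrow> distinct_adj s \<Longrightarrow> distinct_adj (P1 # rep n [P2, P1] @ s)"
  by (induction n) (auto simp: distinct_adj_Cons)

lemma distinct_adj_run_1:
  assumes "k \<ge> 2"
  shows "distinct_adj (P1 # run_1 k @ [P3])" "run_1 k \<noteq> []"
proof -
  have "distinct_adj (P1 # run_1 k @ [P3]) \<and> run_1 k \<noteq> []"
  proof (cases "even k")
    case True
    then obtain n where "k = 2 * Suc n"
      using assms by (metis evenE mult_0_right not0_implies_Suc not_numeral_le_zero)
    then show ?thesis using distinct_adj_rep_32[of n] by (simp add: run_1_def)
  next
    case False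
    then show ?thesis using distinct_adj_rep_32[of "k div 2"] by (simp add: run_1_def)
  qed
  then show "distinct_adj (P1 # run_1 k @ [P3])" "run_1 k \<noteq> []" by auto
qed

lemma distinct_adj_run_3:
  assumes "k \<ge> 2"
  shows "distinct_adj (P1 # run_3 k @ [P3])" "run_3 k \<noteq> []"
proof -
  have "distinct_adj (P1 # run_3 k @ [P3]) \<and> run_3 k \<noteq> []"
  proof (cases "even k")
    case True
    then obtain n where "k = 2 * Suc n"
      using assms by (metis evenE mult_0_right not0_implies_Suc not_numeral_le_zero)
    then show ?thesis using distinct_adj_rep_21[of "[P3]" "Suc n"] by (simp add: run_3_def)
  next
    case False
    then show ?thesis using distinct_adj_rep_21[of "[P2, P3]" "k div 2"] by (simp add: run_3_def)
  qed
  then show "distinct_adj (P1 # run_3 k @ [P3])" "run_3 k \<noteq> []" by auto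
qed

lemma list_all2_replicate_right:
  "list_all2 P ds (replicate k e) \<longleftrightarrow> length ds = k \<and> (\<forall>x\<in>set ds. P x e)"
  by (auto simp: list_all2_conv_all_nth all_set_conv_all_nth)

lemma turns_Cons_replicate:
  "(\<exists>ds. list_all2 (turn \<kappa>) ds (e # replicate k f) \<and> sum_list ds = pi) \<longleftrightarrow>
   (\<exists>d ds. turn \<kappa> d e \<and> length ds = k \<and> (\<forall>x\<in>set ds. turn \<kappa> x f) \<and> d + sum_list ds = pi)"
  (is "?L \<longleftrightarrow> ?R")
proof
  assume ?L
  then obtain d ds where "turn \<kappa> d e" "list_all2 (turn \<kappa>) ds (replicate k f)" "d + sum_list ds = pi"
    by (auto simp: list_all2_Cons2)
  then show ?R
    unfolding list_all2_replicate_right by blast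
next
  assume ?R
  then obtain d ds where "turn \<kappa> d e" "list_all2 (turn \<kappa>) ds (replicate k f)" "d + sum_list ds = pi"
    by (auto simp: list_all2_replicate_right)
  then show ?L
    by (intro exI[of _ "d # ds"]) simp
qed

lemma turns_replicate_snoc:
  "(\<exists>ds. list_all2 (turn \<kappa>) ds (replicate k f @ [e]) \<and> sum_list ds = pi) \<longleftrightarrow>
   (\<exists>d ds. turn \<kappa> d e \<and> length ds = k \<and> (\<forall>x\<in>set ds. turn \<kappa> x f) \<and> d + sum_list ds = pi)"
  (is "?L \<longleftrightarrow> ?R")
proof
  assume ?L
  then obtain d ds where "turn \<kappa> d e" "list_all2 (turn \<kappa>) ds (replicate k f)" "d + sum_list ds = pi"
    by (auto simp: list_all2_append2 list_all2_Cons2 add.commute)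
  then show ?R
    unfolding list_all2_replicate_right by blast
next
  assume ?R
  then obtain d ds where "turn \<kappa> d e" "list_all2 (turn \<kappa>) ds (replicate k f)" "d + sum_list ds = pi"
    by (auto simp: list_all2_replicate_right)
  then show ?L
    by (intro exI[of _ "ds @ [d]"]) (simp add: list_all2_appendI add.commute)
qed

section \<open>Capture conditions of the two families\<close>

context three_masses
begin

lemma capture_run_1:
  assumes "k \<ge> 2"
  shows "capture_process m (run_1 k) \<longleftrightarrow> admissible k (coll_angle m P1) (coll_angle m P3)"
proof -
  have "capture_process m (run_1 k) \<longleftrightarrow> (\<exists>\<kappa>. 0 < \<kappa> \<and> \<kappa> \<le> 1 \<and>
      (\<exists>d ds. turn \<kappa> d (coll_angle m (if even k then P2 else P3)) \<and>
      length ds = k \<and> (\<forall>x\<in>set ds. turn \<kappa> x (coll_angle m P1)) \<and> d + sum_list ds = pi))"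
    unfolding capture_process_iff_turns[OF distinct_adj_run_1[OF assms]] edge_angles_run_1[OF assms]
      turns_Cons_replicate ..
  also have "\<dots> \<longleftrightarrow> real k * coll_angle m P1 < pi \<and>
      sin (if even k then coll_angle m P2 else coll_angle m P3) \<le> sin (real k * coll_angle m P1)"
    by (subst turns_exist_iff) (use coll_angle_bounds assms in auto)
  also have "\<dots> \<longleftrightarrow> admissible k (coll_angle m P1) (coll_angle m P3)"
    using coll_angle_bounds sum_coll_angle assms by (intro admissible_iff_sin) auto
  finally show ?thesis .
qed

lemma capture_run_3:
  assumes "k \<ge> 2"
  shows "capture_process m (run_3 k) \<longleftrightarrow> admissible k (coll_angle m P3) (coll_angle m P1)"
proof -
  have "capture_process m (run_3 k) \<longleftrightarrow> (\<exists>\<kappa>. 0 < \<kappa> \<and> \<kappa> \<le> 1 \<and>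
      (\<exists>d ds. turn \<kappa> d (coll_angle m (if even k then P2 else P1)) \<and>
      length ds = k \<and> (\<forall>x\<in>set ds. turn \<kappa> x (coll_angle m P3)) \<and> d + sum_list ds = pi))"
    unfolding capture_process_iff_turns[OF distinct_adj_run_3[OF assms]] edge_angles_run_3
      turns_replicate_snoc ..
  also have "\<dots> \<longleftrightarrow> real k * coll_angle m P3 < pi \<and>
      sin (if even k then coll_angle m P2 else coll_angle m P1) \<le> sin (real k * coll_angle m P3)"
    by (subst turns_exist_iff) (use coll_angle_bounds assms in auto)
  also have "\<dots> \<longleftrightarrow> admissible k (coll_angle m P3) (coll_angle m P1)"
    using coll_angle_bounds sum_coll_angle assms by (intro admissible_iff_sin) (auto simp: algebra_simps)
  finally show ?thesis .
qed

end

section \<open>Angles as functions of the mass ratios\<close>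

definition ratio_angle :: "real \<Rightarrow> real \<Rightarrow> real" where
  "ratio_angle a b = arctan (a * sqrt ((1 + a + b) / (a * b)))"

lemma ratio_scale_commute: "sqrt ((1 + b + a) / (b * a)) = sqrt ((1 + a + b) / (a * b :: real))"
  by (simp only: ac_simps)

definition unit_masses :: "real \<Rightarrow> real \<Rightarrow> particle \<Rightarrow> real" where
  "unit_masses a b p = (case p of P1 \<Rightarrow> a | P2 \<Rightarrow> 1 | P3 \<Rightarrow> b)"

lemma (in three_masses) coll_angle_ratio:
  "coll_angle m P1 = ratio_angle (m P1 / m P2) (m P3 / m P2)"
  "coll_angle m P3 = ratio_angle (m P3 / m P2) (m P1 / m P2)"
proof -
  have p: "m P1 > 0" "m P2 > 0" "m P3 > 0" by (simp_all add: pos)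
  have "(1 + m P1 / m P2 + m P3 / m P2) / (m P1 / m P2 * (m P3 / m P2)) =
      (m P2)\<^sup>2 * (total_mass m / (m P1 * m P2 * m P3))"
    using p by (simp add: total_mass_def field_simps power2_eq_square)
  then have s: "sqrt ((1 + m P1 / m P2 + m P3 / m P2) / (m P1 / m P2 * (m P3 / m P2))) =
      m P2 * sqrt (total_mass m / (m P1 * m P2 * m P3))"
    using p by (simp only: real_sqrt_mult real_sqrt_abs abs_of_pos)
  then have s': "sqrt ((1 + m P3 / m P2 + m P1 / m P2) / (m P3 / m P2 * (m P1 / m P2))) =
      m P2 * sqrt (total_mass m / (m P1 * m P2 * m P3))"
    by (simp only: ratio_scale_commute)
  show "coll_angle m P1 = ratio_angle (m P1 / m P2) (m P3 / m P2)"
    unfolding coll_angle_def ratio_angle_def s using p by simp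
  show "coll_angle m P3 = ratio_angle (m P3 / m P2) (m P1 / m P2)"
    unfolding coll_angle_def ratio_angle_def s' using p by simp
qed

text \<open>By \<open>coll_angle_ratio\<close> the angles depend on the ratios alone, so a condition
  on them holds for all masses with these ratios or for none; \<open>unit_masses a b\<close> is a
  representative.\<close>

lemma allowed_region_iff:
  assumes "a > 0" "b > 0"
    and P: "\<And>m. three_masses m \<Longrightarrow> capture_process m s \<longleftrightarrow> P (coll_angle m P1) (coll_angle m P3)"
  shows "(a, b) \<in> allowed_region s \<longleftrightarrow> P (ratio_angle a b) (ratio_angle b a)"
proof
  assume "(a, b) \<in> allowed_region s"
  then obtain m where "\<forall>p. m p > 0" and c: "capture_process m s"
    and ab: "a = m P1 / m P2" "b = m P3 / m P2"
    by (auto simp: allowed_region_def)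
  then interpret three_masses m by unfold_locales auto
  show "P (ratio_angle a b) (ratio_angle b a)"
    using P[OF three_masses_axioms] c by (simp add: coll_angle_ratio ab)
next
  assume *: "P (ratio_angle a b) (ratio_angle b a)"
  have u: "unit_masses a b P1 = a" "unit_masses a b P2 = 1" "unit_masses a b P3 = b"
    by (simp_all add: unit_masses_def)
  interpret three_masses "unit_masses a b"
    by unfold_locales (use assms in \<open>auto simp: unit_masses_def split: particle.split\<close>)
  have "capture_process (unit_masses a b) s"
    using * P[OF three_masses_axioms] by (simp add: coll_angle_ratio u)
  then show "(a, b) \<in> allowed_region s"
    unfolding allowed_region_def using pos by (auto intro!: exI[of _ "unit_masses a b"] simp: u)
qed

lemma allowed_run_1:
  assumes "a > 0" "b > 0" "k \<ge> 2"
  shows "(a, b) \<in> allowed_region (run_1 k) \<longleftrightarrow> admissible k (ratio_angle a b) (ratio_angle b a)"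
  using assms by (intro allowed_region_iff three_masses.capture_run_1)

lemma allowed_run_3:
  assumes "a > 0" "b > 0" "k \<ge> 2"
  shows "(a, b) \<in> allowed_region (run_3 k) \<longleftrightarrow> admissible k (ratio_angle b a) (ratio_angle a b)"
  using assms
  by (intro allowed_region_iff[of a b _ "\<lambda>A C. admissible k C A"] three_masses.capture_run_3)

text \<open>These are facts about the angles of \<open>unit_masses a b\<close>. The third angle is
  acute and completes the sum to pi; its tangent is the common scale because particle 2 has mass
  1.\<close>

lemma ratio_angle_bounds:
  assumes "a > 0" "b > 0"
  shows "0 < ratio_angle a b" "ratio_angle a b < pi / 2" "pi / 2 < ratio_angle a b + ratio_angle b a"
    and "tan (ratio_angle a b) * cot (pi - ratio_angle a b - ratio_angle b a) = a"
proof -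
  have u: "unit_masses a b P1 = a" "unit_masses a b P2 = 1" "unit_masses a b P3 = b"
    by (simp_all add: unit_masses_def)
  interpret three_masses "unit_masses a b"
    by unfold_locales (use assms in \<open>auto simp: unit_masses_def split: particle.split\<close>)
  have r: "coll_angle (unit_masses a b) P1 = ratio_angle a b" "coll_angle (unit_masses a b) P3 = ratio_angle b a"
    using coll_angle_ratio by (simp_all add: u)
  show "0 < ratio_angle a b" "ratio_angle a b < pi / 2"
    using coll_angle_bounds[of P1] by (simp_all add: r)
  show "pi / 2 < ratio_angle a b + ratio_angle b a"
    using coll_angle_bounds[of P2] sum_coll_angle by (simp add: r)
  have e: "pi - ratio_angle a b - ratio_angle b a = coll_angle (unit_masses a b) P2"
    using sum_coll_angle by (simp add: r)
  have "tan (coll_angle (unit_masses a b) P2) > 0"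
    using coll_angle_bounds[of P2] by (intro tan_gt_zero) auto
  moreover have "tan (ratio_angle a b) = a * tan (coll_angle (unit_masses a b) P2)"
    unfolding r[symmetric] tan_coll_angle u by simp
  ultimately show "tan (ratio_angle a b) * cot (pi - ratio_angle a b - ratio_angle b a) = a"
    unfolding e by (simp add: cot_altdef)
qed

lemma ratio_angle_le_iff:
  assumes "a > 0" "b > 0"
  shows "ratio_angle a b \<le> ratio_angle b a \<longleftrightarrow> a \<le> b"
proof -
  have "sqrt ((1 + a + b) / (a * b)) > 0"
    using assms by simp
  then show ?thesis
    unfolding ratio_angle_def arctan_le_iff ratio_scale_commute[of b a]
    by (simp only: mult_le_cancel_right_pos)
qed

text \<open>Turns the two coincidences excluded in \<open>admissible_unique_less\<close> into points
  of the curves.\<close>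

lemma capture_curve_memI:
  assumes "a > 0" "b > 0"
  shows "odd j \<Longrightarrow> real j * ratio_angle a b = ratio_angle b a \<Longrightarrow> (a, b) \<in> capture_curve j"
    and "even j \<Longrightarrow> j \<ge> 2 \<Longrightarrow> (real j + 1) * ratio_angle a b = pi - ratio_angle b a \<Longrightarrow>
      (a, b) \<in> capture_curve j"
proof -
  define A C where "A = ratio_angle a b" and "C = ratio_angle b a"
  have b: "C < pi / 2" "pi / 2 < A + C"
    using ratio_angle_bounds[of a b] ratio_angle_bounds[of b a] assms by (auto simp: A_def C_def)
  have ab: "tan A * cot (pi - A - C) = a" "tan C * cot (pi - A - C) = b"
    using ratio_angle_bounds(4)[of a b] ratio_angle_bounds(4)[of b a] assms
    by (auto simp: A_def C_def algebra_simps)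
  show "(a, b) \<in> capture_curve j" if "odd j" "real j * ratio_angle a b = ratio_angle b a"
  proof -
    \<comment> \<open>The index is \<open>2 * k - 1\<close> with \<open>k = Suc n\<close>.\<close>
    obtain n where n: "j = 2 * n + 1" using \<open>odd j\<close> by (rule oddE)
    have "(a, b) \<in> odd_curve (Suc n)"
      using odd_curve_memI[OF b, of "Suc n"] that(2) unfolding ab by (simp add: n A_def C_def)
    then show ?thesis by (simp add: capture_curve_def n)
  qed
  show "(a, b) \<in> capture_curve j"
    if "even j" "j \<ge> 2" "(real j + 1) * ratio_angle a b = pi - ratio_angle b a"
  proof -
    obtain n where n: "j = 2 * n" using \<open>even j\<close> by (rule evenE)
    have "(a, b) \<in> even_curve n"
      using even_curve_memI[OF b, of n] that(2,3) unfolding ab by (simp add: n A_def C_def)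
    then show ?thesis by (simp add: capture_curve_def n)
  qed
qed

section \<open>Covering and uniqueness\<close>

lemma Union_runs:
  "(\<Union>n\<in>{1..}. {rep n [P3, P2], [P2] @ rep n [P3, P2], rep n [P2, P1], rep n [P2, P1] @ [P2]}) =
     (\<Union>k\<in>{2..}. {run_1 k, run_3 k})"
proof (intro equalityI subsetI)
  fix s assume "s \<in> (\<Union>n\<in>{1..}. {rep n [P3, P2], [P2] @ rep n [P3, P2], rep n [P2, P1], rep n [P2, P1] @ [P2]})"
  then obtain n where n: "n \<ge> 1"
    and "s \<in> {rep n [P3, P2], [P2] @ rep n [P3, P2], rep n [P2, P1], rep n [P2, P1] @ [P2]}"
    by auto
  then have "s \<in> {run_1 (2 * n), run_3 (2 * n)} \<or> s \<in> {run_1 (2 * n + 1), run_3 (2 * n + 1)}"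
    by (auto simp: run_1_def run_3_def)
  moreover have "2 * n \<in> {2..}" "2 * n + 1 \<in> {2..}" using n by auto
  ultimately show "s \<in> (\<Union>k\<in>{2..}. {run_1 k, run_3 k})" by blast
next
  fix s assume "s \<in> (\<Union>k\<in>{2..}. {run_1 k, run_3 k})"
  then obtain k where k: "k \<ge> 2" and "s \<in> {run_1 k, run_3 k}" by auto
  then have "s \<in> {rep (k div 2) [P3, P2], [P2] @ rep (k div 2) [P3, P2],
      rep (k div 2) [P2, P1], rep (k div 2) [P2, P1] @ [P2]}"
    by (cases "even k") (auto simp: run_1_def run_3_def)
  moreover have "k div 2 \<in> {1..}" using k by auto
  ultimately show "s \<in> (\<Union>n\<in>{1..}. {rep n [P3, P2], [P2] @ rep n [P3, P2], rep n [P2, P1], rep n [P2, P1] @ [P2]})"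
    by blast
qed

lemma Union_allowed_run_1:
  assumes "k \<ge> 2"
  shows "allowed_region (run_1 k) \<subseteq>
     (\<Union>n\<in>{1..}. allowed_region (rep n [P3, P2]) \<union> allowed_region ([P2] @ rep n [P3, P2]))"
proof -
  have "allowed_region (run_1 k) \<subseteq> allowed_region (rep (k div 2) [P3, P2]) \<union> allowed_region ([P2] @ rep (k div 2) [P3, P2])"
    by (auto simp: run_1_def)
  also have "\<dots> \<subseteq> (\<Union>n\<in>{1..}. allowed_region (rep n [P3, P2]) \<union> allowed_region ([P2] @ rep n [P3, P2]))"
    by (rule UN_upper[of "k div 2"]) (use assms in auto)
  finally show ?thesis .
qed

lemma Union_allowed_run_3:
  assumes "k \<ge> 2"
  shows "allowed_region (run_3 k) \<subseteq>
     (\<Union>n\<in>{1..}. allowed_region (rep n [P2, P1]) \<union> allowed_region (rep n [P2, P1] @ [P2]))"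
proof -
  have "allowed_region (run_3 k) \<subseteq> allowed_region (rep (k div 2) [P2, P1]) \<union> allowed_region (rep (k div 2) [P2, P1] @ [P2])"
    by (auto simp: run_3_def)
  also have "\<dots> \<subseteq> (\<Union>n\<in>{1..}. allowed_region (rep n [P2, P1]) \<union> allowed_region (rep n [P2, P1] @ [P2]))"
    by (rule UN_upper[of "k div 2"]) (use assms in auto)
  finally show ?thesis .
qed

lemma allowed_run_1_exists:
  assumes "b \<ge> a" "a > 0"
  shows "\<exists>k\<ge>2. (a, b) \<in> allowed_region (run_1 k)"
  using admissible_exists[of "ratio_angle a b" "ratio_angle b a"] assms ratio_angle_bounds(1)[of a b]
  by (auto simp: allowed_run_1 ratio_angle_le_iff)

lemma allowed_run_3_exists:
  assumes "a \<ge> b" "b > 0"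
  shows "\<exists>k\<ge>2. (a, b) \<in> allowed_region (run_3 k)"
  using admissible_exists[of "ratio_angle b a" "ratio_angle a b"] assms ratio_angle_bounds(1)[of b a]
  by (auto simp: allowed_run_3 ratio_angle_le_iff)

text \<open>\<open>f\<close> and \<open>g\<close> stand for \<^const>\<open>run_1\<close> and \<^const>\<open>run_3\<close>, in either order.\<close>

lemma unique_run:
  assumes ab: "a > 0" "b > 0" "a < b"
    and f: "\<And>k. k \<ge> 2 \<Longrightarrow> x \<in> allowed_region (f k) \<longleftrightarrow> admissible k (ratio_angle a b) (ratio_angle b a)"
    and g: "\<And>k. k \<ge> 2 \<Longrightarrow> x \<in> allowed_region (g k) \<longleftrightarrow> admissible k (ratio_angle b a) (ratio_angle a b)"
    and curve: "\<forall>j\<ge>1. (a, b) \<notin> capture_curve j"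
  shows "\<exists>!s. s \<in> (\<Union>k\<in>{2..}. {f k, g k}) \<and> x \<in> allowed_region s"
proof -
  define A C where "A = ratio_angle a b" and "C = ratio_angle b a"
  have AC: "0 < A" "C < pi / 2" "pi / 2 < A + C"
    using ratio_angle_bounds[of a b] ratio_angle_bounds[of b a] ab by (auto simp: A_def C_def)
  have lt: "A < C"
    using ratio_angle_le_iff[of b a] ab by (auto simp: A_def C_def)
  obtain k where k: "k \<ge> 2" "admissible k A C"
    using admissible_exists[of A C] AC lt by auto
  have "j \<ge> 1" if "odd j" for j :: nat
    using that by presburger
  then have odd: "odd j \<Longrightarrow> real j * A \<noteq> C" for j
    using capture_curve_memI(1)[OF ab(1,2)] curve by (auto simp: A_def C_def)
  have even: "even j \<Longrightarrow> j \<ge> 2 \<Longrightarrow> (real j + 1) * A \<noteq> pi - C" for j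
    using capture_curve_memI(2)[OF ab(1,2)] curve by (auto simp: A_def C_def)
  show ?thesis
  proof (rule ex1I[of _ "f k"])
    show "f k \<in> (\<Union>k\<in>{2..}. {f k, g k}) \<and> x \<in> allowed_region (f k)"
      using k f by (auto simp: A_def C_def)
  next
    fix s assume "s \<in> (\<Union>k\<in>{2..}. {f k, g k}) \<and> x \<in> allowed_region s"
    then obtain l where l: "l \<ge> 2" "s = f l \<or> s = g l" "x \<in> allowed_region s" by auto
    \<comment> \<open>In the other family the larger angle would be the repeated one, which
      \<open>not_admissible_swap\<close> forbids.\<close>
    then have "s = f l" "admissible l A C"
      using f[of l] g[of l] not_admissible_swap[OF AC(1) lt AC(3)] by (auto simp: A_def C_def)
    then show "s = f k"
      using admissible_unique[OF AC k(1) l(1) k(2)] odd even by auto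
  qed
qed

theorem mainTheorem5:
  shows "({(a, b). b \<ge> a \<and> a > 0} \<subseteq>
           (\<Union>n\<in>{1..}. allowed_region (rep n [P3, P2]) \<union> allowed_region ([P2] @ rep n [P3, P2])))
       \<and> ({(a, b). a \<ge> b \<and> b > 0} \<subseteq>
           (\<Union>n\<in>{1..}. allowed_region (rep n [P2, P1]) \<union> allowed_region (rep n [P2, P1] @ [P2])))
       \<and> (\<forall>a b :: real. a > 0 \<longrightarrow> b > 0 \<longrightarrow>
           (\<forall>m\<ge>1. (a, b) \<notin> capture_curve m \<and> (b, a) \<notin> capture_curve m) \<longrightarrow>
           (\<exists>!s. s \<in> (\<Union>n\<in>{1..}. {rep n [P3, P2], [P2] @ rep n [P3, P2],
                                     rep n [P2, P1], rep n [P2, P1] @ [P2]}) \<and>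
                 (a, b) \<in> allowed_region s))"
proof (intro conjI allI impI)
  show "{(a, b). b \<ge> a \<and> a > 0} \<subseteq>
      (\<Union>n\<in>{1..}. allowed_region (rep n [P3, P2]) \<union> allowed_region ([P2] @ rep n [P3, P2]))"
  proof (intro subsetI, clarify)
    fix a b :: real assume "b \<ge> a" "a > 0"
    then obtain k where "k \<ge> 2" "(a, b) \<in> allowed_region (run_1 k)"
      using allowed_run_1_exists by blast
    then show "(a, b) \<in> (\<Union>n\<in>{1..}. allowed_region (rep n [P3, P2]) \<union> allowed_region ([P2] @ rep n [P3, P2]))"
      using Union_allowed_run_1 by blast
  qed
  show "{(a, b). a \<ge> b \<and> b > 0} \<subseteq>
      (\<Union>n\<in>{1..}. allowed_region (rep n [P2, P1]) \<union> allowed_region (rep n [P2, P1] @ [P2]))"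
  proof (intro subsetI, clarify)
    fix a b :: real assume "a \<ge> b" "b > 0"
    then obtain k where "k \<ge> 2" "(a, b) \<in> allowed_region (run_3 k)"
      using allowed_run_3_exists by blast
    then show "(a, b) \<in> (\<Union>n\<in>{1..}. allowed_region (rep n [P2, P1]) \<union> allowed_region (rep n [P2, P1] @ [P2]))"
      using Union_allowed_run_3 by blast
  qed
next
  fix a b :: real
  assume ab: "a > 0" "b > 0"
    and curve: "\<forall>m\<ge>1. (a, b) \<notin> capture_curve m \<and> (b, a) \<notin> capture_curve m"
  \<comment> \<open>Equal ratios give equal angles, so the point (a, a) lies on C_1.\<close>
  have "a \<noteq> b"
    using capture_curve_memI(1)[of a a 1] ab curve by auto
  then consider "a < b" | "b < a" by linarith
  then show "\<exists>!s. s \<in> (\<Union>n\<in>{1..}. {rep n [P3, P2], [P2] @ rep n [P3, P2],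
                                     rep n [P2, P1], rep n [P2, P1] @ [P2]}) \<and>
                 (a, b) \<in> allowed_region s"
    unfolding Union_runs
  proof cases
    case 1
    then show "\<exists>!s. s \<in> (\<Union>k\<in>{2..}. {run_1 k, run_3 k}) \<and> (a, b) \<in> allowed_region s"
      using ab curve allowed_run_1 allowed_run_3 by (intro unique_run[of a b]) auto
  next
    case 2
    \<comment> \<open>Exchanging the ratios exchanges the roles of the two families.\<close>
    then have "\<exists>!s. s \<in> (\<Union>k\<in>{2..}. {run_3 k, run_1 k}) \<and> (a, b) \<in> allowed_region s"
      using ab curve allowed_run_1 allowed_run_3 by (intro unique_run[of b a]) auto
    then show "\<exists>!s. s \<in> (\<Union>k\<in>{2..}. {run_1 k, run_3 k}) \<and> (a, b) \<in> allowed_region s"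
      by (simp only: insert_commute)
  qed
qed

end
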